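(* Let $k\ge 1$. Let $\mathcal{G}_1$ and $\mathcal{G}_2$ be disjoint two-terminal series-parallel (TTSP) graphs with edge weights in $\mathcal{S}_{++}^k$, with source and sink $(s_1,t_1)$ and $(s_2,t_2)$ respectively. For a TTSP graph $\mathcal{G}$ with source $s$ and sink $t$, let $A_{\mathcal{G}}$ be its Dirichlet Laplacian grounded at the source $s$, let $\mathbf{B}_{\mathcal{G}}=\mathbf{e}_t=e_t\otimes I_k$, and let $\mathcal{H}_2^{\mathcal{G}}$ be the $\mathcal{H}_2$ norm of the leader-follower consensus dynamics $\dot{\mathbf{x}}=-A_{\mathcal{G}}\mathbf{x}+\mathbf{B}_{\mathcal{G}}u$, $y=\mathbf{x}$. Then for $i=1,2$, $$\left(\mathcal{H}_2^{\mathcal{G}_i}\right)^2=\tfrac12\,\mathrm{Tr}\left[\mathbf{B}_{\mathcal{G}_i}^{\intercal}A_{\mathcal{G}_i}^{-1}\mathbf{B}_{\mathcal{G}_i}\right].$$ Furthermore, for the series join $\mathcal{G}_1\odot\mathcal{G}_2$ and the parallel join $\mathcal{G}_1\oslash\mathcal{G}_2$, $$\left(\mathcal{H}_2^{\mathcal{G}_1\odot\mathcal{G}_2}\right)^2=\left(\mathcal{H}_2^{\mathcal{G}_1}\right)^2+\left(\mathcal{H}_2^{\mathcal{G}_2}\right)^2,$$ $$\left(\mathcal{H}_2^{\mathcal{G}_1\oslash\mathcal{G}_2}\right)^2\le\left(\mathcal{H}_2^{\mathcal{G}_1}\right)^2:\left(\mathcal{H}_2^{\mathcal{G}_2}\right)^2,$$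 with equality in the last display if and only if $\rho^{\mathrm{eff}}_{s_1,t_1}=c\,\rho^{\mathrm{eff}}_{s_2,t_2}$ for some $c>0$.
   Context: $\mathcal{S}_{++}^k$ is the set of real symmetric positive-definite $k\times k$ matrices. The parallel sum of symmetric matrices is $A:B=A(A+B)^\dagger B$; for positive scalars $a:b=ab/(a+b)$. TTSP graphs (undirected, multiple edges allowed) with a distinguished source and sink are defined recursively. (1) Two vertices joined by one edge (a 1-path), one vertex being the source and the other the sink, is TTSP. (2) If $\mathcal{G}_1,\mathcal{G}_2$ are disjoint TTSP graphs with sources $s_1,s_2$ and sinks $t_1,t_2$, then so are: the parallel join $\mathcal{G}_1\oslash\mathcal{G}_2$, obtained by identifying $s_1$ with $s_2$ (the new source) and $t_1$ with $t_2$ (the new sink); and the series join $\mathcal{G}_1\odot\mathcal{G}_2$, obtained by identifying $t_1$ with $s_2$, with source $s_1$ and sink $t_2$. Every edge $e$ carries a weight $W_e\in\mathcal{S}_{++}^k$, and joins keep all edges and their weights. Dirichlet Laplacian grounded at $s$: the matrix-weighted Laplacian is $\sum_{e=\{i,j\}}\left((e_i-e_j)\otimes I_k\right)W_e\left((e_i-e_j)\otimes I_k\right)^{\intercal}$ (sum over edges, $e_i$ the standard basis vector of node $i$). $A_{\mathcal{G}}$ is obtained by deleting the $k$ rows and $k$ columns corresponding to $s$. It is indexed by the nodes other than $s$ (in $k\times k$ blocks) and is positive definite since the graph is connected. $\mathcal{H}_2$ norm: for $\dot x=Fx+Bu$, $y=Cx$ with transfer function $G(\sigma)=C(\sigma I-F)^{-1}B$,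 the squared norm is $\frac{1}{2\pi}\int_{-\infty}^{\infty}\mathrm{Tr}[G(j\omega)^*G(j\omega)]\,d\omega$. Effective resistance: regard each edge $e$ as a matrix-valued resistor with conductance $W_e$. Given an intensity $\mathbf{i}\in\mathbb{R}^{k\times k}$, a generalized current from $t$ to $s$ of intensity $\mathbf{i}$ is an assignment of matrices $\mathbf{I}_e\in\mathbb{R}^{k\times k}$ to (arbitrarily oriented) edges such that the net outflow is $\mathbf{i}$ at $t$, $-\mathbf{i}$ at $s$, and $0$ at all other nodes, and such that there are node potentials $\mathbf{V}_p\in\mathbb{R}^{k\times k}$ with $W_e^{-1}\mathbf{I}_e=\mathbf{V}_p-\mathbf{V}_q$ for each edge $e$ oriented from $p$ to $q$. The effective resistance $\rho^{\mathrm{eff}}_{s,t}$ is the $k\times k$ matrix with $\mathbf{V}_t-\mathbf{V}_s=\rho^{\mathrm{eff}}_{s,t}\,\mathbf{i}$ for every $\mathbf{i}$. Here $\rho^{\mathrm{eff}}_{s_i,t_i}$ is computed in $\mathcal{G}_i$. *)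

theory Defs
  imports
    "HOL-Analysis.Interval_Integral"
    "Jordan_Normal_Form.Gauss_Jordan_Elimination"
    "Jordan_Normal_Form.Schur_Decomposition"
    "Jordan_Normal_Form.DL_Submatrix"
begin

section \<open>Matrices\<close>

definition mat_inv :: "'a::field mat \<Rightarrow> 'a mat" where
  "mat_inv A = the (mat_inverse A)"

definition mat_trace :: "'a::comm_monoid_add mat \<Rightarrow> 'a" where
  "mat_trace A = (\<Sum>i<dim_row A. A $$ (i, i))"

definition kron :: "'a::times mat \<Rightarrow> 'a mat \<Rightarrow> 'a mat" where
  "kron A B = Matrix.mat (dim_row A * dim_row B) (dim_col A * dim_col B)
     (\<lambda>(i, j). A $$ (i div dim_row B, j div dim_col B) * B $$ (i mod dim_row B, j mod dim_col B))"

definition mat_sum :: "nat \<Rightarrow> nat \<Rightarrow> ('i \<Rightarrow> 'a::comm_monoid_add mat) \<Rightarrow> 'i set \<Rightarrow> 'a mat" where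
  "mat_sum nr nc f S = Matrix.mat nr nc (\<lambda>(i, j). \<Sum>x\<in>S. f x $$ (i, j))"

definition sym_pos_def :: "nat \<Rightarrow> real mat set" where
  "sym_pos_def k = {W \<in> carrier_mat k k. transpose_mat W = W \<and>
     (\<forall>x\<in>carrier_vec k. x \<noteq> 0\<^sub>v k \<longrightarrow> scalar_prod x (W *\<^sub>v x) > 0)}"

definition par_sum :: "real \<Rightarrow> real \<Rightarrow> real" where
  "par_sum a b = a * b / (a + b)"


section \<open>Two-terminal series-parallel graphs\<close>

text \<open>
  Undirected multigraphs with matrix weights and two distinguished nodes. Edges have their own
  identities, so that multiple edges (even of equal weight) are possible. The pair
  \<open>tail e\<close>, \<open>head e\<close> lists the endpoints of \<open>e\<close> in an arbitrary order: it is a reference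
  orientation, not a direction. The functions are irrelevant outside \<open>edges\<close>.
\<close>

record ('v, 'e) tt_graph =
  verts :: "'v set"
  edges :: "'e set"
  tail :: "'e \<Rightarrow> 'v"
  head :: "'e \<Rightarrow> 'v"
  weight :: "'e \<Rightarrow> real mat"
  source :: 'v
  sink :: 'v

definition disjoint_graphs :: "('v, 'e) tt_graph \<Rightarrow> ('v, 'e) tt_graph \<Rightarrow> bool" where
  "disjoint_graphs G1 G2 \<longleftrightarrow> verts G1 \<inter> verts G2 = {} \<and> edges G1 \<inter> edges G2 = {}"

text \<open>
  The union of two disjoint graphs after the nodes of the second one have been renamed by \<open>r\<close>;
  nodes are identified by renaming a node of \<open>G2\<close> to one of \<open>G1\<close>.
\<close>

definition glue :: "('v \<Rightarrow> 'v) \<Rightarrow> 'v \<Rightarrow> 'v \<Rightarrow> ('v, 'e) tt_graph \<Rightarrow> ('v, 'e) tt_graph \<Rightarrow> ('v, 'e) tt_graph" where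
  "glue r s t G1 G2 = \<lparr>
     verts = verts G1 \<union> r ` verts G2,
     edges = edges G1 \<union> edges G2,
     tail = (\<lambda>e. if e \<in> edges G1 then tail G1 e else r (tail G2 e)),
     head = (\<lambda>e. if e \<in> edges G1 then head G1 e else r (head G2 e)),
     weight = (\<lambda>e. if e \<in> edges G1 then weight G1 e else weight G2 e),
     source = s,
     sink = t\<rparr>"

definition series_join :: "('v, 'e) tt_graph \<Rightarrow> ('v, 'e) tt_graph \<Rightarrow> ('v, 'e) tt_graph" where
  "series_join G1 G2 =
     glue (\<lambda>v. if v = source G2 then sink G1 else v) (source G1) (sink G2) G1 G2"

definition parallel_join :: "('v, 'e) tt_graph \<Rightarrow> ('v, 'e) tt_graph \<Rightarrow> ('v, 'e) tt_graph" where
  "parallel_join G1 G2 =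
     glue (\<lambda>v. if v = source G2 then source G1 else if v = sink G2 then sink G1 else v)
       (source G1) (sink G1) G1 G2"

inductive ttsp :: "nat \<Rightarrow> ('v, 'e) tt_graph \<Rightarrow> bool" for k :: nat where
  one_path: "\<lbrakk>source G \<noteq> sink G; verts G = {source G, sink G}; edges G = {e};
     {tail G e, head G e} = {source G, sink G}; weight G e \<in> sym_pos_def k\<rbrakk> \<Longrightarrow> ttsp k G"
| parallel: "\<lbrakk>ttsp k G1; ttsp k G2; disjoint_graphs G1 G2\<rbrakk> \<Longrightarrow> ttsp k (parallel_join G1 G2)"
| series: "\<lbrakk>ttsp k G1; ttsp k G2; disjoint_graphs G1 G2\<rbrakk> \<Longrightarrow> ttsp k (series_join G1 G2)"


section \<open>Dirichlet Laplacian\<close>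

text \<open>
  Matrix indices require an enumeration of the nodes; any one will do. In \<open>node_list\<close> the source
  comes first, so that grounding at the source deletes the first \<open>k\<close> rows and columns.
\<close>

definition followers :: "('v, 'e) tt_graph \<Rightarrow> 'v list" where
  "followers G = (SOME xs. distinct xs \<and> set xs = verts G - {source G})"

definition node_list :: "('v, 'e) tt_graph \<Rightarrow> 'v list" where
  "node_list G = source G # followers G"

definition basis_col :: "'v list \<Rightarrow> 'v \<Rightarrow> real mat" where
  "basis_col vs v = Matrix.mat (length vs) 1 (\<lambda>(i, j). if vs ! i = v then 1 else 0)"

definition laplacian :: "nat \<Rightarrow> ('v, 'e) tt_graph \<Rightarrow> real mat" where
  "laplacian k G =
     (let vs = node_list G; n = length vs * k;
          d = (\<lambda>e. kron (basis_col vs (tail G e) - basis_col vs (head G e)) (1\<^sub>m k))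
      in mat_sum n n (\<lambda>e. d e * weight G e * transpose_mat (d e)) (edges G))"

definition dirichlet_laplacian :: "nat \<Rightarrow> ('v, 'e) tt_graph \<Rightarrow> real mat" where
  "dirichlet_laplacian k G = submatrix (laplacian k G) {k..} {k..}"

definition sink_input :: "nat \<Rightarrow> ('v, 'e) tt_graph \<Rightarrow> real mat" where
  "sink_input k G = kron (basis_col (followers G) (sink G)) (1\<^sub>m k)"


section \<open>The H2 norm\<close>

definition transfer_function :: "real mat \<Rightarrow> real mat \<Rightarrow> real mat \<Rightarrow> complex \<Rightarrow> complex mat" where
  "transfer_function F B C \<sigma> =
     map_mat complex_of_real C *
     mat_inv (\<sigma> \<cdot>\<^sub>m 1\<^sub>m (dim_row F) - map_mat complex_of_real F) *
     map_mat complex_of_real B"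

text \<open>The trace of \<open>G(j\<omega>)\<^sup>* G(j\<omega>)\<close> is real, so taking the real part only changes its type.\<close>

definition h2_norm :: "real mat \<Rightarrow> real mat \<Rightarrow> real mat \<Rightarrow> real" where
  "h2_norm F B C = sqrt (1 / (2 * pi) *
     (LINT \<omega>|lborel.
        (let T = transfer_function F B C (\<i> * complex_of_real \<omega>)
         in Re (mat_trace (mat_adjoint T * T)))))"

definition consensus_h2 :: "nat \<Rightarrow> ('v, 'e) tt_graph \<Rightarrow> real" where
  "consensus_h2 k G =
     (let A = dirichlet_laplacian k G in h2_norm (- A) (sink_input k G) (1\<^sub>m (dim_row A)))"


section \<open>Effective resistance\<close>

definition net_outflow :: "nat \<Rightarrow> ('v, 'e) tt_graph \<Rightarrow> ('e \<Rightarrow> real mat) \<Rightarrow> 'v \<Rightarrow> real mat" where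
  "net_outflow k G I p =
     mat_sum k k I {e \<in> edges G. tail G e = p} - mat_sum k k I {e \<in> edges G. head G e = p}"

definition generalized_current ::
  "nat \<Rightarrow> ('v, 'e) tt_graph \<Rightarrow> real mat \<Rightarrow> ('e \<Rightarrow> real mat) \<Rightarrow> ('v \<Rightarrow> real mat) \<Rightarrow> bool" where
  "generalized_current k G i I V \<longleftrightarrow>
     (\<forall>e\<in>edges G. I e \<in> carrier_mat k k) \<and>
     (\<forall>p\<in>verts G. V p \<in> carrier_mat k k) \<and>
     (\<forall>p\<in>verts G. net_outflow k G I p =
        (if p = sink G then i else if p = source G then - i else 0\<^sub>m k k)) \<and>
     (\<forall>e\<in>edges G. mat_inv (weight G e) * I e = V (tail G e) - V (head G e))"

definition effective_resistance :: "nat \<Rightarrow> ('v, 'e) tt_graph \<Rightarrow> real mat" where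
  "effective_resistance k G = (THE R. R \<in> carrier_mat k k \<and>
     (\<forall>i\<in>carrier_mat k k. \<forall>I V. generalized_current k G i I V \<longrightarrow>
        V (sink G) - V (source G) = R * i))"

end

theory Submission
  imports
    Defs
    "Jordan_Normal_Form.Jordan_Normal_Form_Existence"
    "HOL-Probability.Sinc_Integral"
begin

text \<open>
  Diagonalizing \<open>A\<close> turns the integrand of the squared norm into a combination of the functions
  \<open>1 / (d\<^sup>2 + \<omega>\<^sup>2)\<close>, whose integrals \<open>\<pi> / d\<close> add up to \<open>1/2 Tr (B\<^sup>T A\<^sup>-\<^sup>1 B)\<close>. The columns of
  \<open>A\<^sup>-\<^sup>1 B\<close> are the node potentials of a unit current from sink to source, so
  \<open>B\<^sup>T A\<^sup>-\<^sup>1 B\<close> is the effective resistance. Gluing currents shows that resistances \<open>R1\<close> and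
  \<open>R2\<close> add up in a series join and have the parallel sum \<open>R1 a\<close> with \<open>(R1 + R2) a = R2\<close> in a
  parallel join. The inequality and its equality case follow since the true split \<open>(a, 1 - a)\<close> of
  a unit current is the unique minimizer of the dissipated energy: the competitor
  \<open>(\<alpha>, 1 - \<alpha>)\<close> with \<open>\<alpha> = Tr R2 / Tr (R1 + R2)\<close> has energy \<open>Tr R1 : Tr R2\<close>.
\<close>

section \<open>Diagonalization of positive definite matrices\<close>

text \<open>The effective resistance is a definite description over all currents. That it denotes
  something rests on two facts: a unit current exists, because the grounded Laplacian is invertible,
  and reciprocity makes the drop of every current the same symmetric matrix applied to its
  intensity. Identifying nodes mixes the outflows at the shared node. In tested form the edge sums
  of the two graphs simply add, and only boundary terms at the terminals remain to be balanced. The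
  series-parallel recursion enters through connectedness; the analysis itself is about connected
  networks. Traces appear because the columns of a matrix-valued current are independent: Tr R is
  the total energy of the k unit currents in the coordinate directions. A scalar split divides all
  of these in the same ratio, whereas the true split may depend on the direction. This is the source
  of the inequality, and equality means that the true split is itself scalar.\<close>

definition diag_of :: "nat \<Rightarrow> (nat \<Rightarrow> 'a::zero) \<Rightarrow> 'a mat" where
  "diag_of n f = Matrix.mat n n (\<lambda>(i, j). if i = j then f i else 0)"

lemma diag_of_carrier[simp]: "diag_of n f \<in> carrier_mat n n"
  "dim_row (diag_of n f) = n" "dim_col (diag_of n f) = n"
  by (simp_all add: diag_of_def)

lemma diag_of_mult: "diag_of n f * diag_of n g = diag_of n (\<lambda>i. f i * g i :: 'a::semiring_0)"
  by (rule eq_matI) (auto simp: diag_of_def scalar_prod_def if_distrib[of "\<lambda>x. x * _"]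
        if_distrib[of "\<lambda>x. _ * x"] sum.delta cong: if_cong)

text \<open>A nonzero entry off the diagonal lies inside a single Jordan block, whose diagonal is
  constant. In this form the later argument can address entries of the whole matrix without keeping
  track of blocks.\<close>

lemma jordan_matrix_index:
  assumes "i < sum_list (map fst n_as)" "j < sum_list (map fst n_as)"
    and "jordan_matrix n_as $$ (i, j) \<noteq> (0 :: 'a::zero_neq_one)"
  shows "j = i \<or> (j = Suc i \<and> jordan_matrix n_as $$ (i, j) = 1 \<and>
    jordan_matrix n_as $$ (i, i) = jordan_matrix n_as $$ (j, j))"
  using assms
proof (induction n_as arbitrary: i j)
  case (Cons na n_as)
  obtain m a where na: "na = (m, a)" by force
  let ?J = "jordan_matrix ((m, a) # n_as)" and ?n = "m + sum_list (map fst n_as)"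
  have idx: "?J $$ (i, j) =
      (if i < m then if j < m then jordan_block m a $$ (i, j) else 0
       else if j < m then 0 else jordan_matrix n_as $$ (i - m, j - m))"
    if "i < ?n" "j < ?n" for i j
    using that unfolding jordan_matrix_Cons by simp
  have prems: "i < ?n" "j < ?n" "?J $$ (i, j) \<noteq> 0"
    using Cons.prems by (simp_all add: na)
  show ?case
  proof (cases "i < m")
    case True
    with prems show ?thesis unfolding na by (simp add: idx split: if_splits)
  next
    case False
    with prems have j: "\<not> j < m" and nz: "jordan_matrix n_as $$ (i - m, j - m) \<noteq> 0"
      by (simp_all add: idx split: if_splits)
    have "i - m < sum_list (map fst n_as)" "j - m < sum_list (map fst n_as)"
      using False j prems(1,2) by linarith+
    from Cons.IH[OF this nz] False j have "j = i \<or> j = Suc i \<and>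
        jordan_matrix n_as $$ (i - m, j - m) = 1 \<and>
        jordan_matrix n_as $$ (i - m, i - m) = jordan_matrix n_as $$ (j - m, j - m)"
      by auto
    with False j prems(1,2) show ?thesis unfolding na by (simp add: idx)
  qed
qed simp

text \<open>The substitution x = d y reduces to the arctangent integral: the measure contributes d
  and the integrand 1/d^2.\<close>

lemma integral_inverse_square_plus:
  fixes d :: real
  assumes "d > 0"
  shows "integrable lborel (\<lambda>x. inverse (d\<^sup>2 + x\<^sup>2))"
    and "(LINT x|lborel. inverse (d\<^sup>2 + x\<^sup>2)) = pi / d"
proof -
  have "has_bochner_integral lborel (\<lambda>x::real. inverse (1 + x^2)) pi"
    using LBINT_inverse_1_plus_square integrable_inverse_1_plus_square
    by (simp add: has_bochner_integral_iff interval_lebesgue_integral_def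
        set_lebesgue_integral_def set_integrable_def)
  from lborel_has_bochner_integral_real_affine_iff[THEN iffD1, OF _ this, of "1/d" 0]
  have "has_bochner_integral lborel (\<lambda>x. inverse (1 + (x / d)^2)) (pi * d)"
    using assms by (simp add: mult.commute)
  then have "has_bochner_integral lborel (\<lambda>x. inverse (1 + (x / d)^2) * (1/d^2)) (pi * d * (1/d^2))"
    by (intro has_bochner_integral_mult_left)
  moreover have "inverse (1 + (x / d)^2) * (1/d^2) = inverse (d\<^sup>2 + x\<^sup>2)" for x
    using assms by (simp add: field_simps)
  moreover have "pi * d * (1/d^2) = pi / d"
    by (simp add: power2_eq_square)
  ultimately have "has_bochner_integral lborel (\<lambda>x. inverse (d\<^sup>2 + x\<^sup>2)) (pi / d)"
    by (simp only:)
  then show "integrable lborel (\<lambda>x. inverse (d\<^sup>2 + x\<^sup>2))"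
    and "(LINT x|lborel. inverse (d\<^sup>2 + x\<^sup>2)) = pi / d"
    by (simp_all add: has_bochner_integral_iff)
qed

section \<open>Hermitian inner product and positive definiteness in coordinates\<close>

definition cdot :: "nat \<Rightarrow> (nat \<Rightarrow> complex) \<Rightarrow> (nat \<Rightarrow> complex) \<Rightarrow> complex" where
  "cdot n x y = (\<Sum>i<n. cnj (x i) * y i)"

lemma cdot_self: "cdot n x x = of_real (\<Sum>i<n. (cmod (x i))\<^sup>2)"
  by (simp add: cdot_def complex_norm_square mult.commute del: of_real_power)

lemma cdot_self_eq_0: "cdot n x x = 0 \<longleftrightarrow> (\<forall>i<n. x i = 0)"
  unfolding cdot_self of_real_eq_0_iff
  by (subst sum_nonneg_eq_0_iff) auto

lemma cdot_self_adjoint: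
  assumes "\<And>i j. i < n \<Longrightarrow> j < n \<Longrightarrow> cnj (M i j) = M j i"
  shows "cdot n (\<lambda>i. \<Sum>j<n. M i j * x j) y = cdot n x (\<lambda>i. \<Sum>j<n. M i j * y j)"
proof -
  have "cdot n (\<lambda>i. \<Sum>j<n. M i j * x j) y = (\<Sum>i<n. \<Sum>j<n. cnj (M i j) * cnj (x j) * y i)"
    by (simp add: cdot_def sum_distrib_right)
  also have "\<dots> = (\<Sum>i<n. \<Sum>j<n. M j i * cnj (x j) * y i)"
    by (intro sum.cong refl) (simp add: assms)
  also have "\<dots> = (\<Sum>j<n. \<Sum>i<n. M j i * cnj (x j) * y i)"
    by (rule sum.swap)
  also have "\<dots> = cdot n x (\<lambda>i. \<Sum>j<n. M i j * y j)"
    by (simp add: cdot_def sum_distrib_left mult_ac)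
  finally show ?thesis .
qed

lemma cdot_scale: "cdot n (\<lambda>i. c * x i) y = cnj c * cdot n x y"
  "cdot n x (\<lambda>i. c * y i) = c * cdot n x y"
  "cdot n x (\<lambda>i. y i + z i) = cdot n x y + cdot n x z"
  by (simp_all add: cdot_def sum_distrib_left sum.distrib algebra_simps)

text \<open>Here x is a total function of which only the values below n matter, so an index below n
  must witness that it does not vanish. Energies are computed as such double sums
  throughout.\<close>

lemma sym_pos_def_quadratic:
  assumes "A \<in> sym_pos_def n" and "i < n" "x i \<noteq> (0::real)"
  shows "(\<Sum>i<n. \<Sum>j<n. x i * A $$ (i, j) * x j) > 0"
proof -
  let ?x = "Matrix.vec n x"
  have A: "A \<in> carrier_mat n n" using assms(1) by (simp add: sym_pos_def_def)
  have "?x \<noteq> 0\<^sub>v n"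
    using assms(2,3) by (metis index_vec index_zero_vec(1))
  with assms(1) have "scalar_prod ?x (A *\<^sub>v ?x) > 0"
    by (simp add: sym_pos_def_def)
  also have "scalar_prod ?x (A *\<^sub>v ?x) = (\<Sum>i<n. \<Sum>j<n. x i * A $$ (i, j) * x j)"
    using A by (simp add: scalar_prod_def sum_distrib_left lessThan_atLeast0 mult.assoc)
  finally show ?thesis .
qed

lemma sym_pos_def_quadratic_nonneg:
  assumes "A \<in> sym_pos_def n"
  shows "(\<Sum>i<n. \<Sum>j<n. x i * A $$ (i, j) * x j) \<ge> (0::real)"
  using sym_pos_def_quadratic[OF assms, of _ x]
  by (cases "\<exists>i<n. x i \<noteq> 0") (force intro: sum_nonneg)+

lemma sym_pos_def_sym:
  assumes "A \<in> sym_pos_def n" "i < n" "j < n"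
  shows "A $$ (i, j) = A $$ (j, i)"
  using assms by (auto simp: sym_pos_def_def) (metis carrier_matD index_transpose_mat(1))

lemma sym_pos_defI:
  assumes "A \<in> carrier_mat n n"
    and "\<And>i j. i < n \<Longrightarrow> j < n \<Longrightarrow> A $$ (i, j) = A $$ (j, i)"
    and "\<And>x i. i < n \<Longrightarrow> x i \<noteq> 0 \<Longrightarrow> (\<Sum>i<n. \<Sum>j<n. x i * A $$ (i, j) * x j) > (0::real)"
  shows "A \<in> sym_pos_def n"
  unfolding sym_pos_def_def
proof (safe)
  show "A \<in> carrier_mat n n" by fact
  show "transpose_mat A = A"
    by (rule eq_matI) (use assms(1,2) in auto)
  fix x :: "real vec" assume x: "x \<in> carrier_vec n" "x \<noteq> 0\<^sub>v n"
  then obtain i where "i < n" "vec_index x i \<noteq> 0"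
    by (metis carrier_vecD eq_vecI index_zero_vec)
  from assms(3)[of i "vec_index x", OF this]
  show "scalar_prod x (A *\<^sub>v x) > 0"
    using assms(1) x by (simp add: scalar_prod_def sum_distrib_left lessThan_atLeast0 mult.assoc)
qed

text \<open>For real A the real part of the Hermitian form splits into the real forms at Re x and Im
  x, at least one of which is positive. Symmetry makes the form its own conjugate, so there is no
  imaginary part.\<close>

lemma sym_pos_def_cdot:
  assumes A: "A \<in> sym_pos_def n" and "i < n" "x i \<noteq> 0"
  shows "\<exists>r>0. cdot n x (\<lambda>i. \<Sum>j<n. of_real (A $$ (i, j)) * x j) = of_real r"
proof -
  let ?q = "cdot n x (\<lambda>i. \<Sum>j<n. of_real (A $$ (i, j)) * x j)"
  have "Re ?q = (\<Sum>i<n. \<Sum>j<n. Re (x i) * A $$ (i, j) * Re (x j)) +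
      (\<Sum>i<n. \<Sum>j<n. Im (x i) * A $$ (i, j) * Im (x j))"
    by (simp add: cdot_def sum_distrib_left sum.distrib algebra_simps)
  moreover from assms(3) have "Re (x i) \<noteq> 0 \<or> Im (x i) \<noteq> 0"
    by (simp add: complex_eq_iff)
  ultimately have "Re ?q > 0"
    using sym_pos_def_quadratic[OF A assms(2), of "\<lambda>i. Re (x i)"]
      sym_pos_def_quadratic[OF A assms(2), of "\<lambda>i. Im (x i)"]
      sym_pos_def_quadratic_nonneg[OF A, of "\<lambda>i. Re (x i)"]
      sym_pos_def_quadratic_nonneg[OF A, of "\<lambda>i. Im (x i)"] by fastforce
  moreover have "cnj ?q = ?q"
  proof -
    have "cnj ?q = cdot n (\<lambda>i. \<Sum>j<n. of_real (A $$ (i, j)) * x j) x"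
      by (simp add: cdot_def mult.commute)
    also have "\<dots> = ?q"
      by (rule cdot_self_adjoint) (simp add: sym_pos_def_sym[OF A])
    finally show ?thesis .
  qed
  ultimately show ?thesis
    by (intro exI[of _ "Re ?q"] conjI) (simp_all only: Reals_cnj_iff[symmetric] of_real_Re)
qed

text \<open>A Jordan block of size at least two would contain an eigenvector \<open>p\<close> and a vector
  \<open>q\<close> with \<open>A q = d q + p\<close>; moving the self-adjoint \<open>A\<close> across the inner product of
  \<open>p\<close> and \<open>q\<close> gives \<open>p = 0\<close>.\<close>

lemma sym_pos_def_diagonalizable:
  assumes A: "A \<in> sym_pos_def n"
  obtains P Q :: "complex mat" and d :: "nat \<Rightarrow> real" where
    "P \<in> carrier_mat n n" "Q \<in> carrier_mat n n" "P * Q = 1\<^sub>m n" "Q * P = 1\<^sub>m n"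
    "\<And>i. i < n \<Longrightarrow> d i > 0"
    "map_mat complex_of_real A = P * diag_of n (\<lambda>i. complex_of_real (d i)) * Q"
proof -
  let ?A = "map_mat complex_of_real A"
  have A': "?A \<in> carrier_mat n n" using A by (simp add: sym_pos_def_def)
  obtain as where "char_poly ?A = (\<Prod>a\<leftarrow>as. [:- a, 1:])"
    using char_poly_factorized[OF A'] by auto
  from jordan_nf_exists[OF A' this] obtain n_as where "jordan_nf ?A n_as" by auto
  then obtain P Q where "similar_mat_wit ?A (jordan_matrix n_as) P Q"
    by (auto simp: jordan_nf_def similar_mat_def)
  from similar_mat_witD[OF _ this, of n] A'
  have PQ: "P * Q = 1\<^sub>m n" "Q * P = 1\<^sub>m n" "?A = P * jordan_matrix n_as * Q"
    "P \<in> carrier_mat n n" "Q \<in> carrier_mat n n" and J: "jordan_matrix n_as \<in> carrier_mat n n"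
    by auto
  define J where "J = jordan_matrix n_as"
  have Jc: "J \<in> carrier_mat n n" using J by (simp add: J_def)
  have len: "sum_list (map fst n_as) = n" using J by auto
  \<comment> \<open>\<open>p l\<close> is column l of P, and \<open>ap\<close> is the action of A on
    such coordinate functions. The equation AP = PJ then says how A acts on the columns.\<close>
  define p where "p = (\<lambda>l i. P $$ (i, l))"
  define ap where "ap = (\<lambda>x i. \<Sum>j<n. complex_of_real (A $$ (i, j)) * x j)"
  have AP: "?A * P = P * J"
  proof -
    have "?A * P = P * J * (Q * P)"
      unfolding PQ(3) J_def[symmetric] using PQ(4,5) Jc by (simp add: assoc_mult_mat[of _ n n _ n _ n])
    then show ?thesis using PQ Jc by simp
  qed
  have ap: "ap (p l) i = (\<Sum>j<n. p j i * J $$ (j, l))" if "i < n" "l < n" for i l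
  proof -
    have "(?A * P) $$ (i, l) = (P * J) $$ (i, l)" using AP by simp
    then show ?thesis using that PQ(4,5) Jc A'
      by (simp add: scalar_prod_def ap_def p_def lessThan_atLeast0)
  qed
  have pnz: "\<exists>i<n. p l i \<noteq> 0" if "l < n" for l
  proof (rule ccontr)
    assume "\<not> ?thesis"
    then have "(Q * P) $$ (l, l) = 0" using that PQ(4,5) by (simp add: p_def scalar_prod_def)
    then show False using that PQ by simp
  qed
  have pp: "cdot n (p l) (p l) \<noteq> 0" if "l < n" for l
    using pnz[OF that] by (auto simp: cdot_self_eq_0)
  have adj: "cdot n (ap x) y = cdot n x (ap y)" for x y
    unfolding ap_def by (rule cdot_self_adjoint) (simp add: sym_pos_def_sym[OF A])
  have cdot_cong: "cdot n x y = cdot n x' y'"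
    if "\<And>i. i < n \<Longrightarrow> x i = x' i" "\<And>i. i < n \<Longrightarrow> y i = y' i" for x y x' y'
    using that by (simp add: cdot_def)
  have jordan: "j = l \<or> Suc j = l \<and> J $$ (j, l) = 1 \<and> J $$ (j, j) = J $$ (l, l)"
    if "j < n" "l < n" "J $$ (j, l) \<noteq> 0" for j l
    using jordan_matrix_index[of j n_as l] that by (auto simp: len J_def)
  \<comment> \<open>If column l of J vanishes off the diagonal, then \<open>p l\<close> is an
    eigenvector. Its eigenvalue is the Rayleigh quotient of \<open>p l\<close>, hence real and
    positive.\<close>
  have eig: "\<exists>r>0. J $$ (l, l) = of_real r \<and> (\<forall>i<n. ap (p l) i = of_real r * p l i)"
    if l: "l < n" and off: "\<And>j. j < n \<Longrightarrow> j \<noteq> l \<Longrightarrow> J $$ (j, l) = 0" for l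
  proof -
    have e: "ap (p l) i = J $$ (l, l) * p l i" if "i < n" for i
    proof -
      have "ap (p l) i = (\<Sum>j<n. if j = l then p l i * J $$ (l, l) else 0)"
        unfolding ap[OF that l] by (intro sum.cong) (auto simp: off)
      then show ?thesis using l by simp
    qed
    obtain i where "i < n" "p l i \<noteq> 0" using pnz[OF l] by auto
    from sym_pos_def_cdot[where x = "p l", OF A this] obtain r where r: "r > 0" "cdot n (p l) (ap (p l)) = of_real r"
      unfolding ap_def by auto
    have "cdot n (p l) (ap (p l)) = J $$ (l, l) * cdot n (p l) (p l)"
      unfolding cdot_scale(2)[symmetric] by (rule cdot_cong) (auto simp: e)
    with r(2) have J: "J $$ (l, l) = of_real (r / (\<Sum>i<n. (cmod (p l i))\<^sup>2))"
      using pp[OF l] by (simp add: cdot_self field_simps del: of_real_sum)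
    moreover have "(\<Sum>i<n. (cmod (p l i))\<^sup>2) \<ge> 0" by (simp add: sum_nonneg)
    moreover have "(\<Sum>i<n. (cmod (p l i))\<^sup>2) \<noteq> 0"
      using pp[OF l] unfolding cdot_self of_real_eq_0_iff .
    ultimately show ?thesis using r(1) e by (intro exI[of _ "r / (\<Sum>i<n. (cmod (p l i))\<^sup>2)"]) auto
  qed
  \<comment> \<open>Strong induction on the row: once the entry above the diagonal in column l is
    known to vanish, \<open>p l\<close> is a genuine eigenvector, and a nonzero entry at (l, l+1)
    would make \<open>p (Suc l)\<close> a generalized one.\<close>
  have nosuper: "J $$ (j, Suc j) = 0" if "Suc j < n" for j
    using that
  proof (induction j rule: less_induct)
    case (less l)
    show ?case
    proof (rule ccontr)
      assume nz: "J $$ (l, Suc l) \<noteq> 0"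
      have l: "l < n" using less.prems by simp
      have "J $$ (j, l) = 0" if "j < n" "j \<noteq> l" for j
        using jordan[OF that(1) l] less.IH[of j] l that by auto
      from eig[OF l this] obtain r where r: "J $$ (l, l) = of_real r"
        "\<And>i. i < n \<Longrightarrow> ap (p l) i = of_real r * p l i" by auto
      have e: "ap (p (Suc l)) i = of_real r * p (Suc l) i + p l i" if "i < n" for i
      proof -
        have "p j i * J $$ (j, Suc l) =
            (if j = l then p l i else 0) + (if j = Suc l then of_real r * p (Suc l) i else 0)"
          if "j < n" for j
          using jordan[OF that less.prems] jordan[OF l less.prems nz] r by auto
        then show ?thesis unfolding ap[OF that less.prems]
          using l less.prems by (simp add: sum.distrib)
      qed
      \<comment> \<open>Because r is real it leaves the conjugated slot unchanged. Both ways of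
        computing the product then contain the same multiple of r, and what is left over is the
        squared norm of \<open>p l\<close>.\<close>
      have "of_real r * cdot n (p l) (p (Suc l)) = cdot n (\<lambda>i. of_real r * p l i) (p (Suc l))"
        by (simp add: cdot_scale)
      also have "\<dots> = cdot n (ap (p l)) (p (Suc l))"
        by (rule cdot_cong) (auto simp: r)
      also have "\<dots> = cdot n (p l) (ap (p (Suc l)))" by (rule adj)
      also have "\<dots> = cdot n (p l) (\<lambda>i. of_real r * p (Suc l) i + p l i)"
        by (rule cdot_cong) (auto simp: e)
      also have "\<dots> = of_real r * cdot n (p l) (p (Suc l)) + cdot n (p l) (p l)"
        by (simp add: cdot_scale)
      finally show False using pp[OF l] by simp
    qed
  qed
  have off: "J $$ (j, l) = 0" if "j < n" "l < n" "j \<noteq> l" for j l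
    using jordan[OF that(1,2)] nosuper[of j] that by auto
  define d where "d = (\<lambda>l. Re (J $$ (l, l)))"
  have d: "d l > 0 \<and> J $$ (l, l) = of_real (d l)" if l: "l < n" for l
  proof -
    obtain r where "r > 0" "J $$ (l, l) = of_real r"
      using eig[OF l off[OF _ l]] by blast
    then show ?thesis by (simp add: d_def)
  qed
  have "J = diag_of n (\<lambda>i. complex_of_real (d i))"
    by (rule eq_matI) (use Jc d off in \<open>auto simp: diag_of_def\<close>)
  with PQ(3) have "?A = P * diag_of n (\<lambda>i. complex_of_real (d i)) * Q" by (simp add: J_def)
  with that[of P Q d] PQ d show ?thesis by auto
qed

section \<open>Inverses, adjoints and traces of matrices\<close>

lemma mat_inverse_unique:
  fixes A :: "'a::field mat"
  assumes "A \<in> carrier_mat n n" "B \<in> carrier_mat n n" "C \<in> carrier_mat n n"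
    and "B * A = 1\<^sub>m n" "A * C = 1\<^sub>m n"
  shows "B = C"
proof -
  have "B = B * (A * C)" using assms by simp
  also have "\<dots> = (B * A) * C" using assms(1-3) by (simp add: assoc_mult_mat[of _ n n _ n _ n] mult_carrier_mat[of _ n n _ n])
  finally show ?thesis using assms by simp
qed

text \<open>\<open>mat_inv\<close> extracts the content of an option, so it is meaningful only once
  \<open>None\<close> has been excluded; an explicit two-sided inverse makes A a unit of the matrix
  ring and does so.\<close>

lemma mat_inv_eqI:
  fixes A :: "'a::field mat"
  assumes "A \<in> carrier_mat n n" "B \<in> carrier_mat n n" "A * B = 1\<^sub>m n" "B * A = 1\<^sub>m n"
  shows "mat_inv A = B"
proof (cases "mat_inverse A")
  case None
  from mat_inverse(1)[OF assms(1) this, of "()"] assms have False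
    by (auto simp: Units_def ring_mat_def)
  then show ?thesis ..
next
  case (Some C)
  from mat_inverse(2)[OF assms(1) this] assms mat_inverse_unique[of A n C B] Some
  show ?thesis by (simp add: mat_inv_def)
qed

lemma sym_pos_def_mat_inv:
  assumes A: "A \<in> sym_pos_def n"
  shows "mat_inv A \<in> carrier_mat n n" "A * mat_inv A = 1\<^sub>m n" "mat_inv A * A = 1\<^sub>m n"
proof -
  have A': "A \<in> carrier_mat n n" using A by (simp add: sym_pos_def_def)
  have "Determinant.det A \<noteq> 0"
    unfolding det_0_iff_vec_prod_zero[OF A']
  proof safe
    fix v assume v: "v \<in> carrier_vec n" "v \<noteq> 0\<^sub>v n" "A *\<^sub>v v = 0\<^sub>v n"
    with A have "scalar_prod v (A *\<^sub>v v) > 0" unfolding sym_pos_def_def by blast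
    with v show False by simp
  qed
  from det_non_zero_imp_unit[OF A' this, of "()"] obtain B where
    B: "B \<in> carrier_mat n n" "A * B = 1\<^sub>m n" "B * A = 1\<^sub>m n"
    by (auto simp: Units_def ring_mat_def)
  then show "mat_inv A \<in> carrier_mat n n" "A * mat_inv A = 1\<^sub>m n" "mat_inv A * A = 1\<^sub>m n"
    by (simp_all only: mat_inv_eqI[OF A' B])
qed

lemma mat_adjoint_carrier:
  "mat_adjoint A \<in> carrier_mat (dim_col A) (dim_row A)"
  unfolding mat_adjoint_def
  by (rule carrier_matI) (simp_all only: mat_of_rows_carrier length_map cols_length)

lemma mat_adjoint_index:
  "i < dim_col A \<Longrightarrow> j < dim_row A \<Longrightarrow> mat_adjoint A $$ (i, j) = cnj (A $$ (j, i))"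
  unfolding mat_adjoint_def by (subst mat_of_rows_index) simp_all

lemma map_mat_of_real_mult:
  assumes "A \<in> carrier_mat n m" "B \<in> carrier_mat m l"
  shows "map_mat complex_of_real (A * B) = map_mat complex_of_real A * map_mat complex_of_real B"
  by (rule eq_matI) (use assms in \<open>auto simp: scalar_prod_def\<close>)

lemma mat_trace_congruence:
  fixes M :: "'a::comm_semiring_1 mat"
  assumes "M \<in> carrier_mat n n" "B \<in> carrier_mat n m"
  shows "mat_trace (transpose_mat B * M * B) =
    (\<Sum>c<m. \<Sum>i<n. \<Sum>j<n. B $$ (i, c) * M $$ (i, j) * B $$ (j, c))"
  using assms
  by (simp add: mat_trace_def scalar_prod_def sum_distrib_left lessThan_atLeast0 mult.assoc)

section \<open>The H2 norm\<close>

text \<open>\<open>psi\<close> is the functional calculus of A: it is multiplicative and sends 1 to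
  the identity. The resolvent and its adjoint on the imaginary axis both lie in its image, so the
  integrand is computed eigenvalue by eigenvalue.\<close>

lemma h2_norm_sym_pos_def:
  assumes A: "A \<in> sym_pos_def n" and B: "B \<in> carrier_mat n m"
  shows "(h2_norm (- A) B (1\<^sub>m n))\<^sup>2 = 1 / 2 * mat_trace (transpose_mat B * mat_inv A * B)"
proof -
  have A': "A \<in> carrier_mat n n" using A by (simp add: sym_pos_def_def)
  obtain P Q :: "complex mat" and d :: "nat \<Rightarrow> real" where
    PQ: "P \<in> carrier_mat n n" "Q \<in> carrier_mat n n" "P * Q = 1\<^sub>m n" "Q * P = 1\<^sub>m n" and
    d: "\<And>i. i < n \<Longrightarrow> d i > 0" and
    Ad: "map_mat complex_of_real A = P * diag_of n (\<lambda>i. complex_of_real (d i)) * Q"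
    using sym_pos_def_diagonalizable[OF A] by metis
  define psi where "psi f = P * diag_of n f * Q" for f
  have psi_carrier[simp]: "psi f \<in> carrier_mat n n" for f
    unfolding psi_def by (intro mult_carrier_mat[of _ n n] PQ diag_of_carrier)
  have psi_dim[simp]: "dim_row (psi f) = n" "dim_col (psi f) = n" for f
    by (rule carrier_matD[OF psi_carrier])+
  have psi_mult: "psi f * psi g = psi (\<lambda>l. f l * g l)" for f g
  proof -
    have "psi f * psi g = P * diag_of n f * (Q * P) * diag_of n g * Q"
      unfolding psi_def using PQ(1,2)
      by (simp add: assoc_mult_mat[of _ n n _ n _ n] mult_carrier_mat[of _ n n _ n])
    also have "\<dots> = P * (diag_of n f * diag_of n g) * Q"
      using PQ by (simp add: assoc_mult_mat[of _ n n _ n _ n] mult_carrier_mat[of _ n n _ n])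
    finally show ?thesis by (simp add: psi_def diag_of_mult)
  qed
  have psi_index: "psi f $$ (i, j) = (\<Sum>l<n. P $$ (i, l) * Q $$ (l, j) * f l)"
    if "i < n" "j < n" for f i j
    using that PQ
    by (simp add: psi_def scalar_prod_def diag_of_def lessThan_atLeast0 if_distrib[of "\<lambda>x. _ * x"]
        mult_ac cong: if_cong)
  have psi_cong: "psi f = psi g" if "\<And>l. l < n \<Longrightarrow> f l = g l" for f g
    by (rule eq_matI) (auto simp: psi_index that)
  have psi_1: "psi (\<lambda>l. 1) = 1\<^sub>m n"
  proof -
    have "diag_of n (\<lambda>l. 1) = (1\<^sub>m n :: complex mat)"
      by (rule eq_matI) (auto simp: diag_of_def)
    then show ?thesis using PQ by (simp add: psi_def)
  qed
  have psi_inverse: "psi f * psi (\<lambda>l. inverse (f l)) = 1\<^sub>m n" "psi (\<lambda>l. inverse (f l)) * psi f = 1\<^sub>m n"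
    if "\<And>l. l < n \<Longrightarrow> f l \<noteq> 0" for f
    using psi_cong[of "\<lambda>l. f l * inverse (f l)" "\<lambda>l. 1"] that
    by (auto simp: psi_mult psi_1 mult.commute)
  have shift: "\<sigma> \<cdot>\<^sub>m 1\<^sub>m n - map_mat complex_of_real (- A) = psi (\<lambda>l. \<sigma> + of_real (d l))" for \<sigma>
  proof (rule eq_matI)
    fix i j assume "i < dim_row (psi (\<lambda>l. \<sigma> + of_real (d l)))" "j < dim_col (psi (\<lambda>l. \<sigma> + of_real (d l)))"
    then have ij: "i < n" "j < n" using psi_carrier by auto
    have "psi (\<lambda>l. \<sigma> + of_real (d l)) $$ (i, j) =
        \<sigma> * psi (\<lambda>l. 1) $$ (i, j) + psi (\<lambda>l. of_real (d l)) $$ (i, j)"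
      using ij by (simp add: psi_index sum_distrib_left sum.distrib algebra_simps)
    moreover have "psi (\<lambda>l. of_real (d l)) = map_mat complex_of_real A"
      by (simp add: psi_def Ad)
    ultimately show "(\<sigma> \<cdot>\<^sub>m 1\<^sub>m n - map_mat complex_of_real (- A)) $$ (i, j) =
        psi (\<lambda>l. \<sigma> + of_real (d l)) $$ (i, j)"
      using ij A' by (simp add: psi_1)
  qed (use A' psi_carrier in auto)
  \<comment> \<open>The real part \<open>d l\<close> is positive, so no pole of the transfer
    function lies on the imaginary axis.\<close>
  have nz: "\<i> * of_real \<omega> + of_real (d l) \<noteq> 0" "- (\<i> * of_real \<omega>) + of_real (d l) \<noteq> 0"
    if "l < n" for l \<omega>
    using d[OF that] by (auto simp: complex_eq_iff)
  define B' where "B' = map_mat complex_of_real B"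
  have B': "B' \<in> carrier_mat n m" using B by (simp add: B'_def)
  define T where "T \<omega> = transfer_function (- A) B (1\<^sub>m n) (\<i> * complex_of_real \<omega>)" for \<omega>
  define g where "g \<omega> l = inverse (\<i> * complex_of_real \<omega> + of_real (d l))" for \<omega> l
  have T: "T \<omega> = psi (g \<omega>) * B'" for \<omega>
  proof -
    have "mat_inv (psi (\<lambda>l. \<i> * of_real \<omega> + of_real (d l))) = psi (g \<omega>)"
      unfolding g_def by (rule mat_inv_eqI[of _ n]) (use nz in \<open>simp_all add: psi_inverse\<close>)
    moreover have "map_mat complex_of_real (1\<^sub>m n) = 1\<^sub>m n"
      by (rule eq_matI) auto
    ultimately show ?thesis
      using A' by (simp add: T_def transfer_function_def shift B'_def)
  qed
  \<comment> \<open>P is not assumed unitary, so the adjoint of \<open>psi (g \<omega>)\<close>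
    cannot be read off the factorization. As A is real symmetric, that adjoint is a left inverse of
    the shifted matrix at -\<omega>, and \<open>psi (g (- \<omega>))\<close> is a right inverse of
    it; hence they agree.\<close>
  have g_cnj: "cnj (psi (g \<omega>) $$ (j, i)) = psi (g (- \<omega>)) $$ (i, j)" if "i < n" "j < n" for i j \<omega>
  proof -
    define N where "N = mat_adjoint (psi (g \<omega>))"
    have N: "N \<in> carrier_mat n n"
      using mat_adjoint_carrier[of "psi (g \<omega>)"] psi_carrier[of "g \<omega>"] by (simp add: N_def)
    let ?f = "\<lambda>\<omega> l. \<i> * complex_of_real \<omega> + of_real (d l)"
    have adj: "psi (?f (- \<omega>)) $$ (i, j) = cnj (psi (?f \<omega>) $$ (j, i))" if "i < n" "j < n" for i j
      using that A' unfolding shift[symmetric] by (auto simp: sym_pos_def_sym[OF A])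
    have N1: "N * psi (?f (- \<omega>)) = 1\<^sub>m n"
    proof (rule eq_matI)
      fix i j assume "i < dim_row (1\<^sub>m n)" "j < dim_col (1\<^sub>m n)"
      then have ij: "i < n" "j < n" by auto
      have "(N * psi (?f (- \<omega>))) $$ (i, j) = cnj ((psi (?f \<omega>) * psi (g \<omega>)) $$ (j, i))"
        using ij N by (simp add: scalar_prod_def N_def mat_adjoint_index adj mult.commute
            del: of_real_minus)
      also have "psi (?f \<omega>) * psi (g \<omega>) = 1\<^sub>m n"
        unfolding g_def by (rule psi_inverse) (rule nz)
      finally show "(N * psi (?f (- \<omega>))) $$ (i, j) = 1\<^sub>m n $$ (i, j)" using ij by simp
    qed (use N in simp_all)
    have N2: "psi (?f (- \<omega>)) * psi (g (- \<omega>)) = 1\<^sub>m n"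
      unfolding g_def by (rule psi_inverse) (rule nz)
    have "cnj (psi (g \<omega>) $$ (j, i)) = N $$ (i, j)"
      unfolding N_def by (rule mat_adjoint_index[symmetric]) (simp_all only: psi_dim that)
    also have "N = psi (g (- \<omega>))"
      by (rule mat_inverse_unique[OF psi_carrier N psi_carrier N1 N2])
    finally show ?thesis .
  qed
  \<comment> \<open>Trace of B^T E B for the rank-one spectral projection E formed from column l of
    P and row l of Q. The trace of any \<open>psi f\<close> between B^T and B is then a linear
    combination of the values of f.\<close>
  define C where "C l = (\<Sum>c<m. \<Sum>i<n. \<Sum>j<n. B' $$ (i, c) * (P $$ (i, l) * Q $$ (l, j)) * B' $$ (j, c))"
    for l
  have tr: "mat_trace (transpose_mat B' * psi f * B') = (\<Sum>l<n. C l * f l)" for f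
  proof -
    have "mat_trace (transpose_mat B' * psi f * B') = (\<Sum>c<m. \<Sum>i<n. \<Sum>j<n. \<Sum>l<n.
        B' $$ (i, c) * (P $$ (i, l) * Q $$ (l, j)) * B' $$ (j, c) * f l)"
      by (subst mat_trace_congruence[OF _ B'])
        (auto simp: psi_index sum_distrib_left sum_distrib_right mult_ac intro!: sum.cong)
    also have "\<dots> = (\<Sum>c<m. \<Sum>i<n. \<Sum>l<n. \<Sum>j<n.
        B' $$ (i, c) * (P $$ (i, l) * Q $$ (l, j)) * B' $$ (j, c) * f l)"
      by (intro sum.cong refl sum.swap)
    also have "\<dots> = (\<Sum>c<m. \<Sum>l<n. \<Sum>i<n. \<Sum>j<n.
        B' $$ (i, c) * (P $$ (i, l) * Q $$ (l, j)) * B' $$ (j, c) * f l)"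
      by (intro sum.cong refl sum.swap)
    also have "\<dots> = (\<Sum>l<n. \<Sum>c<m. \<Sum>i<n. \<Sum>j<n.
        B' $$ (i, c) * (P $$ (i, l) * Q $$ (l, j)) * B' $$ (j, c) * f l)"
      by (rule sum.swap)
    finally show ?thesis by (simp add: C_def sum_distrib_right)
  qed
  have T_carrier: "T \<omega> \<in> carrier_mat n m" for \<omega>
    using B' unfolding T by (rule mult_carrier_mat[OF psi_carrier])
  have adj_carrier: "mat_adjoint (T \<omega>) \<in> carrier_mat m n" for \<omega>
    using mat_adjoint_carrier[of "T \<omega>"] by (simp only: carrier_matD[OF T_carrier])
  have adj_T: "mat_adjoint (T \<omega>) = transpose_mat B' * psi (g (- \<omega>))" for \<omega>
  proof (rule eq_matI)
    have cb: "cnj (B' $$ (l, i)) = B' $$ (l, i)" if "l < n" "i < m" for l i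
      using that B by (auto simp: B'_def)
    fix i j assume "i < dim_row (transpose_mat B' * psi (g (- \<omega>)))" "j < dim_col (transpose_mat B' * psi (g (- \<omega>)))"
    then have ij: "i < m" "j < n" using B' by (auto)
    then have "mat_adjoint (T \<omega>) $$ (i, j) = cnj (T \<omega> $$ (j, i))"
      using T_carrier[of \<omega>] by (simp add: mat_adjoint_index)
    also have "\<dots> = (\<Sum>l<n. psi (g (- \<omega>)) $$ (l, j) * B' $$ (l, i))"
      using ij B' by (simp add: T scalar_prod_def lessThan_atLeast0 g_cnj cb)
    finally show "mat_adjoint (T \<omega>) $$ (i, j) = (transpose_mat B' * psi (g (- \<omega>))) $$ (i, j)"
      using ij B' by (simp add: scalar_prod_def lessThan_atLeast0 mult.commute)
  qed (use B' adj_carrier[of \<omega>] in simp_all)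
  have integrand: "Re (mat_trace (mat_adjoint (T \<omega>) * T \<omega>)) =
      (\<Sum>l<n. Re (C l) * inverse ((d l)\<^sup>2 + \<omega>\<^sup>2))" for \<omega>
  proof -
    have Bt: "transpose_mat B' \<in> carrier_mat m n" by (rule transpose_carrier_mat[THEN iffD2, OF B'])
    have "mat_adjoint (T \<omega>) * T \<omega> = transpose_mat B' * psi (g (- \<omega>)) * psi (g \<omega>) * B'"
      unfolding adj_T unfolding T
      by (rule assoc_mult_mat[OF mult_carrier_mat[OF Bt psi_carrier] psi_carrier B', symmetric])
    also have "transpose_mat B' * psi (g (- \<omega>)) * psi (g \<omega>) = transpose_mat B' * (psi (g (- \<omega>)) * psi (g \<omega>))"
      by (rule assoc_mult_mat[OF Bt psi_carrier psi_carrier])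
    also have "psi (g (- \<omega>)) * psi (g \<omega>) = psi (\<lambda>l. of_real (inverse ((d l)\<^sup>2 + \<omega>\<^sup>2)))"
      unfolding psi_mult
    proof (rule psi_cong)
      fix l
      have "(\<i> * complex_of_real (- \<omega>) + of_real (d l)) * (\<i> * complex_of_real \<omega> + of_real (d l)) =
          of_real ((d l)\<^sup>2 + \<omega>\<^sup>2)"
        by (simp add: complex_eq_iff power2_eq_square algebra_simps)
      then show "g (- \<omega>) l * g \<omega> l = of_real (inverse ((d l)\<^sup>2 + \<omega>\<^sup>2))"
        by (simp only: g_def inverse_mult_distrib[symmetric] of_real_inverse)
    qed
    finally show ?thesis by (simp add: tr del: of_real_inverse)
  qed
  \<comment> \<open>The norm is a square root, and squaring it gives back its argument only if the
    integral is nonnegative.\<close>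
  have nonneg: "Re (mat_trace (mat_adjoint (T \<omega>) * T \<omega>)) \<ge> 0" for \<omega>
  proof -
    have "mat_trace (mat_adjoint (T \<omega>) * T \<omega>) = (\<Sum>c<m. \<Sum>i<n. cnj (T \<omega> $$ (i, c)) * T \<omega> $$ (i, c))"
      using T_carrier[of \<omega>] adj_carrier[of \<omega>]
      by (simp add: mat_trace_def scalar_prod_def mat_adjoint_index lessThan_atLeast0)
    then show ?thesis by (simp add: sum_nonneg)
  qed
  have "(LINT \<omega>|lborel. Re (mat_trace (mat_adjoint (T \<omega>) * T \<omega>))) =
      (\<Sum>l<n. LINT \<omega>|lborel. Re (C l) * inverse ((d l)\<^sup>2 + \<omega>\<^sup>2))"
    unfolding integrand
    by (intro Bochner_Integration.integral_sum integrable_mult_right integral_inverse_square_plus(1) d) simp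
  also have "\<dots> = (\<Sum>l<n. Re (C l) * (pi / d l))"
    by (intro sum.cong refl) (simp add: integral_inverse_square_plus(2)[OF d])
  also have "\<dots> = pi * (\<Sum>l<n. Re (C l) * inverse (d l))"
    by (simp add: sum_distrib_left field_simps)
  \<comment> \<open>The same trace formula read backwards: \<open>psi\<close> at the reciprocal
    eigenvalues is the inverse of A.\<close>
  also have "(\<Sum>l<n. Re (C l) * inverse (d l)) = mat_trace (transpose_mat B * mat_inv A * B)"
  proof -
    have "map_mat complex_of_real (mat_inv A) = psi (\<lambda>l. inverse (of_real (d l)))"
    proof (rule mat_inverse_unique[of "map_mat complex_of_real A" n])
      show "map_mat complex_of_real (mat_inv A) * map_mat complex_of_real A = 1\<^sub>m n"
        using sym_pos_def_mat_inv[OF A] A'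
        by (subst map_mat_of_real_mult[symmetric, of _ n n _ n]) (auto intro!: eq_matI)
      show "map_mat complex_of_real A * psi (\<lambda>l. inverse (complex_of_real (d l))) = 1\<^sub>m n"
        unfolding Ad psi_def[symmetric]
        by (rule psi_inverse) (use d in force)
    qed (use A' sym_pos_def_mat_inv[OF A] in auto)
    then have "(\<Sum>l<n. C l * inverse (of_real (d l))) =
        mat_trace (transpose_mat B' * map_mat complex_of_real (mat_inv A) * B')"
      by (simp add: tr)
    also have "\<dots> = (\<Sum>c<m. \<Sum>i<n. \<Sum>j<n.
        B' $$ (i, c) * map_mat complex_of_real (mat_inv A) $$ (i, j) * B' $$ (j, c))"
      by (rule mat_trace_congruence[OF _ B']) (simp add: sym_pos_def_mat_inv(1)[OF A])
    also have "\<dots> = of_real (\<Sum>c<m. \<Sum>i<n. \<Sum>j<n. B $$ (i, c) * mat_inv A $$ (i, j) * B $$ (j, c))"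
      unfolding of_real_sum using B sym_pos_def_mat_inv(1)[OF A]
      by (intro sum.cong refl) (simp add: B'_def)
    also have "\<dots> = of_real (mat_trace (transpose_mat B * mat_inv A * B))"
      by (simp only: mat_trace_congruence[OF sym_pos_def_mat_inv(1)[OF A] B])
    finally have "Re (\<Sum>l<n. C l * inverse (of_real (d l))) = mat_trace (transpose_mat B * mat_inv A * B)"
      by (simp only: Re_complex_of_real)
    moreover have "Re (\<Sum>l<n. C l * inverse (of_real (d l))) = (\<Sum>l<n. Re (C l) * inverse (d l))"
      by (simp add: of_real_inverse[symmetric] del: of_real_inverse)
    ultimately show ?thesis by (simp only:)
  qed
  finally have int: "(LINT \<omega>|lborel. Re (mat_trace (mat_adjoint (T \<omega>) * T \<omega>))) =
      pi * mat_trace (transpose_mat B * mat_inv A * B)" .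
  have "(LINT \<omega>|lborel. Re (mat_trace (mat_adjoint (T \<omega>) * T \<omega>))) \<ge> 0"
    by (rule Bochner_Integration.integral_nonneg) (rule nonneg)
  moreover have "(sqrt (1 / (2 * pi) * (pi * x)))\<^sup>2 = 1 / 2 * x" if "pi * x \<ge> 0" for x :: real
  proof -
    have "x \<ge> 0" using that pi_gt_zero unfolding zero_le_mult_iff by linarith
    then show ?thesis by simp
  qed
  ultimately show ?thesis
    unfolding h2_norm_def Let_def T_def[symmetric] int by blast
qed

section \<open>Currents and effective resistance\<close>

text \<open>Connectedness is expressed without walks, as the absence of nonconstant functions with
  zero difference along every edge. This is the form that definiteness of the grounded Laplacian
  consumes, and it passes through gluing by restricting and pulling back functions.\<close>

definition connected_network :: "nat \<Rightarrow> ('v, 'e) tt_graph \<Rightarrow> bool" where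
  "connected_network k G \<longleftrightarrow> finite (verts G) \<and> finite (edges G) \<and>
     source G \<in> verts G \<and> sink G \<in> verts G \<and> source G \<noteq> sink G \<and>
     (\<forall>e\<in>edges G. tail G e \<in> verts G \<and> head G e \<in> verts G \<and> weight G e \<in> sym_pos_def k) \<and>
     (\<forall>f :: 'v \<Rightarrow> real. (\<forall>e\<in>edges G. f (tail G e) = f (head G e)) \<longrightarrow>
        (\<forall>v\<in>verts G. f v = f (source G)))"

lemma connected_networkD:
  assumes "connected_network k G"
  shows "finite (verts G)" "finite (edges G)" "source G \<in> verts G" "sink G \<in> verts G"
    "source G \<noteq> sink G"
    "e \<in> edges G \<Longrightarrow> tail G e \<in> verts G" "e \<in> edges G \<Longrightarrow> head G e \<in> verts G"
    "e \<in> edges G \<Longrightarrow> weight G e \<in> sym_pos_def k"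
    "e \<in> edges G \<Longrightarrow> weight G e \<in> carrier_mat k k"
  using assms by (auto simp: connected_network_def sym_pos_def_def)

lemma connected_network_constant:
  fixes f :: "'v \<Rightarrow> real" and G :: "('v, 'e) tt_graph"
  assumes "connected_network k G" "\<And>e. e \<in> edges G \<Longrightarrow> f (tail G e) = f (head G e)" "v \<in> verts G"
  shows "f v = f (source G)"
  using assms unfolding connected_network_def by blast

section \<open>Connectedness under gluing\<close>

lemma glue_simps:
  "verts (glue r s t G1 G2) = verts G1 \<union> r ` verts G2"
  "edges (glue r s t G1 G2) = edges G1 \<union> edges G2"
  "source (glue r s t G1 G2) = s" "sink (glue r s t G1 G2) = t"
  "e \<in> edges G1 \<Longrightarrow> tail (glue r s t G1 G2) e = tail G1 e"
  "e \<in> edges G1 \<Longrightarrow> head (glue r s t G1 G2) e = head G1 e"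
  "e \<in> edges G1 \<Longrightarrow> weight (glue r s t G1 G2) e = weight G1 e"
  "e \<notin> edges G1 \<Longrightarrow> tail (glue r s t G1 G2) e = r (tail G2 e)"
  "e \<notin> edges G1 \<Longrightarrow> head (glue r s t G1 G2) e = r (head G2 e)"
  "e \<notin> edges G1 \<Longrightarrow> weight (glue r s t G1 G2) e = weight G2 e"
  by (simp_all add: glue_def)

text \<open>A function that is constant along the glued edges restricts to \<open>G1\<close> and
  pulls back along r to \<open>G2\<close>. The two resulting constants agree because r sends the
  source of \<open>G2\<close> into \<open>G1\<close>.\<close>

lemma connected_network_glue:
  fixes G1 G2 :: "('v, 'e) tt_graph"
  assumes G1: "connected_network k G1" and G2: "connected_network k G2" and disj: "disjoint_graphs G1 G2"
    and "r (source G2) \<in> verts G1" "t \<in> verts G1 \<union> r ` verts G2" "t \<noteq> source G1"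
  shows "connected_network k (glue r (source G1) t G1 G2)"
proof -
  have E: "e \<notin> edges G1" if "e \<in> edges G2" for e
    using disj that by (auto simp: disjoint_graphs_def)
  have "f v = f (source (glue r (source G1) t G1 G2))"
    if f: "\<forall>e\<in>edges (glue r (source G1) t G1 G2).
        f (tail (glue r (source G1) t G1 G2) e) = f (head (glue r (source G1) t G1 G2) e)"
      and v: "v \<in> verts (glue r (source G1) t G1 G2)" for f :: "'v \<Rightarrow> real" and v
  proof -
    have f1: "f v = f (source G1)" if "v \<in> verts G1" for v
    proof (rule connected_network_constant[OF G1 _ that])
      show "f (tail G1 e) = f (head G1 e)" if "e \<in> edges G1" for e
        using f[rule_format, of e] that by (simp add: glue_def)
    qed
    have "f (r v) = f (r (source G2))" if "v \<in> verts G2" for v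
    proof (rule connected_network_constant[OF G2 _ that])
      show "f (r (tail G2 e)) = f (r (head G2 e))" if "e \<in> edges G2" for e
        using f[rule_format, of e] E[OF that] that by (simp add: glue_def)
    qed
    with v f1 assms(4) show ?thesis by (auto simp: glue_def)
  qed
  moreover have "finite (verts (glue r (source G1) t G1 G2))"
    "finite (edges (glue r (source G1) t G1 G2))"
    using connected_networkD[OF G1] connected_networkD[OF G2] by (simp_all add: glue_def)
  moreover have "source (glue r (source G1) t G1 G2) \<in> verts (glue r (source G1) t G1 G2)"
    "sink (glue r (source G1) t G1 G2) \<in> verts (glue r (source G1) t G1 G2)"
    "source (glue r (source G1) t G1 G2) \<noteq> sink (glue r (source G1) t G1 G2)"
    using connected_networkD(3)[OF G1] assms by (auto simp: glue_def)
  moreover have "\<forall>e\<in>edges (glue r (source G1) t G1 G2).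
      tail (glue r (source G1) t G1 G2) e \<in> verts (glue r (source G1) t G1 G2) \<and>
      head (glue r (source G1) t G1 G2) e \<in> verts (glue r (source G1) t G1 G2) \<and>
      weight (glue r (source G1) t G1 G2) e \<in> sym_pos_def k"
    using connected_networkD[OF G1] connected_networkD[OF G2] E by (auto simp: glue_def)
  ultimately show ?thesis unfolding connected_network_def by simp
qed

lemma connected_network_parallel_join:
  assumes "connected_network k G1" "connected_network k G2" "disjoint_graphs G1 G2"
  shows "connected_network k (parallel_join G1 G2)"
  unfolding parallel_join_def using connected_networkD[OF assms(1)]
  by (intro connected_network_glue assms) auto

lemma connected_network_series_join:
  assumes "connected_network k G1" "connected_network k G2" "disjoint_graphs G1 G2"
  shows "connected_network k (series_join G1 G2)"
  unfolding series_join_def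
proof (rule connected_network_glue[OF assms])
  show "sink G2 \<in> verts G1 \<union> (\<lambda>v. if v = source G2 then sink G1 else v) ` verts G2"
    using connected_networkD(4,5)[OF assms(2)] by (auto intro!: rev_image_eqI[of "sink G2"])
  show "sink G2 \<noteq> source G1"
    using connected_networkD(4)[OF assms(2)] connected_networkD(3)[OF assms(1)] assms(3)
    by (auto simp: disjoint_graphs_def)
qed (use connected_networkD(4)[OF assms(1)] in simp)

text \<open>The recursive definition of the graphs is consumed here; what follows is stated for
  connected networks and their joins.\<close>

lemma ttsp_connected_network: "ttsp k G \<Longrightarrow> connected_network k G"
proof (induction rule: ttsp.induct)
  case (one_path G e)
  then have "tail G e = source G \<and> head G e = sink G \<or> tail G e = sink G \<and> head G e = source G"
    by (auto simp: doubleton_eq_iff)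
  with one_path show ?case by (auto simp: connected_network_def)
qed (simp_all add: connected_network_parallel_join connected_network_series_join)

text \<open>Kirchhoff's current law in weak form, that is, tested against an arbitrary function on the
  nodes. In this form it is compatible with the identification of nodes.\<close>

definition potential :: "nat \<Rightarrow> ('v, 'e) tt_graph \<Rightarrow> real mat \<Rightarrow> ('v \<Rightarrow> real mat) \<Rightarrow> bool" where
  "potential k G i V \<longleftrightarrow> i \<in> carrier_mat k k \<and> (\<forall>p\<in>verts G. V p \<in> carrier_mat k k) \<and>
     (\<forall>\<phi> :: 'v \<Rightarrow> real. \<forall>a<k. \<forall>c<k.
        (\<Sum>e\<in>edges G. (\<phi> (tail G e) - \<phi> (head G e)) *
          (weight G e * (V (tail G e) - V (head G e))) $$ (a, c)) =
        (\<phi> (sink G) - \<phi> (source G)) * i $$ (a, c))"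

section \<open>Kirchhoff's law in weak and in pointwise form\<close>

lemma potentialD:
  assumes "potential k G i V"
  shows "i \<in> carrier_mat k k" "p \<in> verts G \<Longrightarrow> V p \<in> carrier_mat k k"
    "a < k \<Longrightarrow> c < k \<Longrightarrow> (\<Sum>e\<in>edges G. (\<phi> (tail G e) - \<phi> (head G e)) *
        (weight G e * (V (tail G e) - V (head G e))) $$ (a, c)) =
      (\<phi> (sink G) - \<phi> (source G)) * i $$ (a, c)"
  using assms by (auto simp: potential_def)

lemma potential_drop_carrier:
  assumes "connected_network k G" "potential k G i V" "e \<in> edges G"
  shows "V (tail G e) - V (head G e) \<in> carrier_mat k k"
  using potentialD(2)[OF assms(2)] connected_networkD(6,7)[OF assms(1,3)]
  by (simp add: minus_carrier_mat)

text \<open>Discrete integration by parts: the gradient of \<phi> paired with an edge function f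
  equals \<phi> paired with the divergence of f.\<close>

lemma sum_edges_by_parts:
  fixes f :: "'e \<Rightarrow> real"
  assumes "connected_network k G"
  shows "(\<Sum>e\<in>edges G. (\<phi> (tail G e) - \<phi> (head G e)) * f e) =
    (\<Sum>p\<in>verts G. \<phi> p * (sum f {e \<in> edges G. tail G e = p} - sum f {e \<in> edges G. head G e = p}))"
proof -
  note G = connected_networkD[OF assms]
  have *: "(\<Sum>p\<in>verts G. \<phi> p * sum f {e \<in> edges G. g e = p}) = (\<Sum>e\<in>edges G. \<phi> (g e) * f e)"
    if "g ` edges G \<subseteq> verts G" for g
  proof -
    have "(\<Sum>p\<in>verts G. \<phi> p * sum f {e \<in> edges G. g e = p}) =
        (\<Sum>p\<in>verts G. \<Sum>e\<in>{e \<in> edges G. g e = p}. \<phi> (g e) * f e)"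
      by (simp add: sum_distrib_left)
    also have "\<dots> = (\<Sum>e\<in>edges G. \<phi> (g e) * f e)"
      by (rule sum.group) (use G that in auto)
    finally show ?thesis .
  qed
  show ?thesis
    using *[of "tail G"] *[of "head G"] G
    by (simp add: right_diff_distrib left_diff_distrib sum_subtractf image_subset_iff)
qed

lemma net_outflow_index:
  "a < k \<Longrightarrow> c < k \<Longrightarrow> net_outflow k G I p $$ (a, c) =
    (\<Sum>e\<in>{e \<in> edges G. tail G e = p}. I e $$ (a, c)) - (\<Sum>e\<in>{e \<in> edges G. head G e = p}. I e $$ (a, c))"
  by (simp add: net_outflow_def mat_sum_def)

lemma net_outflow_carrier: "net_outflow k G I p \<in> carrier_mat k k"
  by (simp add: net_outflow_def mat_sum_def minus_carrier_mat)

text \<open>Currents are defined through resistances, potentials through conductances. This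
  translation eliminates the edge currents, leaving the node potentials as the only unknown.\<close>

lemma ohm:
  assumes G: "connected_network k G" and e: "e \<in> edges G" and "I \<in> carrier_mat k k" "D \<in> carrier_mat k k"
  shows "mat_inv (weight G e) * I = D \<longleftrightarrow> I = weight G e * D"
proof -
  note W = connected_networkD(9)[OF G e] sym_pos_def_mat_inv[OF connected_networkD(8)[OF G e]]
  have 1: "weight G e * (mat_inv (weight G e) * I) = I"
    by (simp only: assoc_mult_mat[OF W(1,2) assms(3), symmetric] W(3) left_mult_one_mat[OF assms(3)])
  have 2: "mat_inv (weight G e) * (weight G e * D) = D"
    by (simp only: assoc_mult_mat[OF W(2,1) assms(4), symmetric] W(4) left_mult_one_mat[OF assms(4)])
  show ?thesis
  proof
    assume "mat_inv (weight G e) * I = D"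
    with 1 show "I = weight G e * D" by (simp only:)
  next
    assume "I = weight G e * D"
    with 2 show "mat_inv (weight G e) * I = D" by (simp only:)
  qed
qed

lemma generalized_current_imp_potential:
  assumes G: "connected_network k G" and i: "i \<in> carrier_mat k k"
    and gc: "generalized_current k G i I V"
  shows "potential k G i V"
  unfolding potential_def
proof (intro conjI ballI allI impI)
  note gc' = gc[unfolded generalized_current_def]
  show Vc: "V p \<in> carrier_mat k k" if "p \<in> verts G" for p
    by (rule gc'[THEN conjunct2, THEN conjunct1, rule_format, OF that])
  have I: "I e = weight G e * (V (tail G e) - V (head G e))" if "e \<in> edges G" for e
  proof -
    have "mat_inv (weight G e) * I e = V (tail G e) - V (head G e)"
      by (rule gc'[THEN conjunct2, THEN conjunct2, THEN conjunct2, rule_format, OF that])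
    then show ?thesis
      by (rule ohm[OF G that gc'[THEN conjunct1, rule_format, OF that]
            minus_carrier_mat[OF Vc[OF connected_networkD(7)[OF G that]]], THEN iffD1])
  qed
  fix \<phi> :: "'a \<Rightarrow> real" and a c assume ac: "a < k" "c < k"
  have "(\<Sum>e\<in>edges G. (\<phi> (tail G e) - \<phi> (head G e)) *
      (weight G e * (V (tail G e) - V (head G e))) $$ (a, c)) =
      (\<Sum>e\<in>edges G. (\<phi> (tail G e) - \<phi> (head G e)) * I e $$ (a, c))"
    by (intro sum.cong refl) (simp add: I)
  also have "\<dots> = (\<Sum>p\<in>verts G. \<phi> p * net_outflow k G I p $$ (a, c))"
    using ac by (simp add: sum_edges_by_parts[OF G, of \<phi> "\<lambda>e. I e $$ (a, c)"] net_outflow_index)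
  also have "\<dots> = (\<Sum>p\<in>verts G. (if p = sink G then \<phi> (sink G) * i $$ (a, c) else 0) -
      (if p = source G then \<phi> (source G) * i $$ (a, c) else 0))"
    using i ac connected_networkD(5)[OF G]
    by (intro sum.cong refl) (auto simp: gc'[THEN conjunct2, THEN conjunct2, THEN conjunct1, rule_format])
  also have "\<dots> = (\<phi> (sink G) - \<phi> (source G)) * i $$ (a, c)"
    using connected_networkD[OF G] by (simp add: sum_subtractf left_diff_distrib)
  finally show "(\<Sum>e\<in>edges G. (\<phi> (tail G e) - \<phi> (head G e)) *
      (weight G e * (V (tail G e) - V (head G e))) $$ (a, c)) =
      (\<phi> (sink G) - \<phi> (source G)) * i $$ (a, c)" .
qed (rule i)

lemma potential_imp_generalized_current:
  assumes G: "connected_network k G" and V: "potential k G i V"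
  shows "generalized_current k G i (\<lambda>e. weight G e * (V (tail G e) - V (head G e))) V"
proof -
  let ?I = "\<lambda>e. weight G e * (V (tail G e) - V (head G e))"
  note D = potential_drop_carrier[OF G V]
  have I: "?I e \<in> carrier_mat k k" if "e \<in> edges G" for e
    using connected_networkD(9)[OF G that] D[OF that] by (rule mult_carrier_mat)
  have "net_outflow k G ?I p = (if p = sink G then i else if p = source G then - i else 0\<^sub>m k k)"
    if p: "p \<in> verts G" for p
  proof (rule eq_matI)
    let ?r = "if p = sink G then i else if p = source G then - i else 0\<^sub>m k k"
    have r: "?r \<in> carrier_mat k k" using potentialD(1)[OF V] by auto
    then show "dim_row (net_outflow k G ?I p) = dim_row ?r" "dim_col (net_outflow k G ?I p) = dim_col ?r"
      using net_outflow_carrier[of k G ?I p] by auto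
    fix a c assume "a < dim_row ?r" "c < dim_col ?r"
    then have ac: "a < k" "c < k" using r by auto
    \<comment> \<open>Testing with the indicator of p isolates the outflow at p.\<close>
    let ?\<phi> = "\<lambda>q. if q = p then 1 else 0 :: real"
    have "net_outflow k G ?I p $$ (a, c) = (\<Sum>q\<in>verts G. if q = p then net_outflow k G ?I p $$ (a, c) else 0)"
      using p connected_networkD(1)[OF G] by simp
    also have "\<dots> = (\<Sum>q\<in>verts G. ?\<phi> q * net_outflow k G ?I q $$ (a, c))"
      by (intro sum.cong refl) simp
    also have "\<dots> = (?\<phi> (sink G) - ?\<phi> (source G)) * i $$ (a, c)"
      unfolding net_outflow_index[OF ac] sum_edges_by_parts[OF G, symmetric]
      by (rule potentialD(3)[OF V ac])
    also have "\<dots> = ?r $$ (a, c)"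
      using ac connected_networkD(5)[OF G] potentialD(1)[OF V] by auto
    finally show "net_outflow k G ?I p $$ (a, c) = ?r $$ (a, c)" .
  qed
  moreover have "mat_inv (weight G e) * ?I e = V (tail G e) - V (head G e)" if "e \<in> edges G" for e
    using ohm[OF G that I[OF that] D[OF that]] by simp
  ultimately show ?thesis
    unfolding generalized_current_def using I potentialD(2)[OF V] by (intro conjI ballI)
qed

section \<open>Power, reciprocity and the resistance of a unit current\<close>

lemma mult_mat_index:
  fixes A :: "real mat"
  assumes "A \<in> carrier_mat k k" "D \<in> carrier_mat k k" "a < k" "c < k"
  shows "(A * D) $$ (a, c) = (\<Sum>b<k. A $$ (a, b) * D $$ (b, c))"
  using assms by (simp add: scalar_prod_def lessThan_atLeast0)

lemma transpose_mult_index: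
  fixes A :: "real mat"
  assumes "A \<in> carrier_mat k k" "B \<in> carrier_mat k k" "c < k" "d < k"
  shows "(transpose_mat A * B) $$ (c, d) = (\<Sum>a<k. A $$ (a, c) * B $$ (a, d))"
  using assms by (simp add: scalar_prod_def lessThan_atLeast0)

lemma transpose_eq_index:
  assumes "transpose_mat A = A" "A \<in> carrier_mat n n" "i < n" "j < n"
  shows "A $$ (i, j) = A $$ (j, i)"
proof -
  have "transpose_mat A $$ (i, j) = A $$ (j, i)"
    by (rule index_transpose_mat(1)) (simp_all only: carrier_matD[OF assms(2)] assms(3,4))
  then show ?thesis by (simp only: assms(1))
qed

text \<open>Entry (c, d) of the matrix-valued Dirichlet form, the sum over the edges of (dU)^T W dV,
  where d denotes the drop along an edge. For U = V the diagonal entries are dissipated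
  powers.\<close>

definition mutual_power :: "nat \<Rightarrow> ('v, 'e) tt_graph \<Rightarrow> ('v \<Rightarrow> real mat) \<Rightarrow> ('v \<Rightarrow> real mat) \<Rightarrow> nat \<Rightarrow> nat \<Rightarrow> real" where
  "mutual_power k G U V c d = (\<Sum>e\<in>edges G. \<Sum>a<k. \<Sum>b<k.
     (U (tail G e) - U (head G e)) $$ (a, c) * weight G e $$ (a, b) * (V (tail G e) - V (head G e)) $$ (b, d))"

lemma mutual_power_commute:
  assumes G: "connected_network k G"
  shows "mutual_power k G U V c d = mutual_power k G V U d c"
  unfolding mutual_power_def
proof (rule sum.cong[OF refl])
  fix e assume e: "e \<in> edges G"
  let ?u = "\<lambda>a. (U (tail G e) - U (head G e)) $$ (a, c)"
  let ?v = "\<lambda>a. (V (tail G e) - V (head G e)) $$ (a, d)"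
  have "(\<Sum>a<k. \<Sum>b<k. ?u a * weight G e $$ (a, b) * ?v b) = (\<Sum>b<k. \<Sum>a<k. ?u a * weight G e $$ (a, b) * ?v b)"
    by (rule sum.swap)
  also have "\<dots> = (\<Sum>a<k. \<Sum>b<k. ?v a * weight G e $$ (a, b) * ?u b)"
    by (intro sum.cong refl) (simp add: sym_pos_def_sym[OF connected_networkD(8)[OF G e]])
  finally show "(\<Sum>a<k. \<Sum>b<k. ?u a * weight G e $$ (a, b) * ?v b) =
      (\<Sum>a<k. \<Sum>b<k. ?v a * weight G e $$ (a, b) * ?u b)" .
qed

text \<open>For each row a, the entry function p \<mapsto> \<open>U p $$ (a, c)\<close> is used as
  test function in the law for V, and the results are added over a. U may be any matrix-valued
  function on the nodes.\<close>

lemma potential_power: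
  assumes G: "connected_network k G" and V: "potential k G i V"
    and U: "\<And>p. p \<in> verts G \<Longrightarrow> U p \<in> carrier_mat k k" and cd: "c < k" "d < k"
  shows "(\<Sum>a<k. (U (sink G) - U (source G)) $$ (a, c) * i $$ (a, d)) = mutual_power k G U V c d"
proof -
  have diff: "(U p - U q) $$ (a, c) = U p $$ (a, c) - U q $$ (a, c)"
    if "p \<in> verts G" "q \<in> verts G" "a < k" for p q a
    using that U[OF that(1)] U[OF that(2)] cd by simp
  note D = potential_drop_carrier[OF G V]
  have "(\<Sum>a<k. (U (sink G) - U (source G)) $$ (a, c) * i $$ (a, d)) =
      (\<Sum>a<k. (U (sink G) $$ (a, c) - U (source G) $$ (a, c)) * i $$ (a, d))"
    using connected_networkD(3,4)[OF G] by (simp add: diff)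
  also have "\<dots> = (\<Sum>a<k. \<Sum>e\<in>edges G. (U (tail G e) $$ (a, c) - U (head G e) $$ (a, c)) *
      (weight G e * (V (tail G e) - V (head G e))) $$ (a, d))"
    by (intro sum.cong refl potentialD(3)[OF V, symmetric]) (use cd in auto)
  also have "\<dots> = (\<Sum>a<k. \<Sum>e\<in>edges G. \<Sum>b<k. (U (tail G e) - U (head G e)) $$ (a, c) *
      weight G e $$ (a, b) * (V (tail G e) - V (head G e)) $$ (b, d))"
  proof (intro sum.cong refl)
    fix a e assume "a \<in> {..<k}" and e: "e \<in> edges G"
    then have a: "a < k" by simp
    show "(U (tail G e) $$ (a, c) - U (head G e) $$ (a, c)) *
        (weight G e * (V (tail G e) - V (head G e))) $$ (a, d) =
        (\<Sum>b<k. (U (tail G e) - U (head G e)) $$ (a, c) *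
          weight G e $$ (a, b) * (V (tail G e) - V (head G e)) $$ (b, d))"
      unfolding mult_mat_index[OF connected_networkD(9)[OF G e] D[OF e] a cd(2)]
      using a connected_networkD(6,7)[OF G e]
      by (simp add: diff sum_distrib_left mult.assoc)
  qed
  also have "\<dots> = mutual_power k G U V c d"
    unfolding mutual_power_def by (rule sum.swap)
  finally show ?thesis .
qed

lemma network_energy_pos:
  assumes G: "connected_network k G" and e: "e \<in> edges G" and a: "a < k" "y e a \<noteq> (0::real)"
  shows "(\<Sum>e\<in>edges G. \<Sum>a<k. \<Sum>b<k. y e a * weight G e $$ (a, b) * y e b) > 0"
proof (rule sum_pos2[OF connected_networkD(2)[OF G] e])
  show "0 < (\<Sum>a<k. \<Sum>b<k. y e a * weight G e $$ (a, b) * y e b)"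
    by (rule sym_pos_def_quadratic[OF connected_networkD(8)[OF G e] a(1)]) (rule a(2))
  show "0 \<le> (\<Sum>a<k. \<Sum>b<k. y e a * weight G e $$ (a, b) * y e b)" if "e \<in> edges G" for e
    by (rule sym_pos_def_quadratic_nonneg[OF connected_networkD(8)[OF G that]])
qed

text \<open>Reciprocity: testing Kirchhoff's law for one current with the potential of another gives an
  expression that is symmetric in the two.\<close>

lemma unit_potential_reciprocity:
  assumes G: "connected_network k G" and V: "potential k G (1\<^sub>m k) V" and U: "potential k G i U"
  shows "U (sink G) - U (source G) = transpose_mat (V (sink G) - V (source G)) * i"
proof (rule eq_matI)
  let ?R = "V (sink G) - V (source G)"
  have R: "?R \<in> carrier_mat k k" "U (sink G) - U (source G) \<in> carrier_mat k k"
    using potentialD(2)[OF V] potentialD(2)[OF U] connected_networkD(3,4)[OF G]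
    by (simp_all add: minus_carrier_mat)
  note i = potentialD(1)[OF U]
  have Ri: "transpose_mat ?R * i \<in> carrier_mat k k"
    by (rule mult_carrier_mat[OF transpose_carrier_mat[THEN iffD2, OF R(1)] i])
  show "dim_row (U (sink G) - U (source G)) = dim_row (transpose_mat ?R * i)"
    "dim_col (U (sink G) - U (source G)) = dim_col (transpose_mat ?R * i)"
    unfolding carrier_matD[OF Ri] carrier_matD[OF R(2)] by (rule refl)+
  fix c d assume "c < dim_row (transpose_mat ?R * i)" "d < dim_col (transpose_mat ?R * i)"
  then have cd: "c < k" "d < k" unfolding carrier_matD[OF Ri] .
  have "(U (sink G) - U (source G)) $$ (c, d) =
      (\<Sum>a<k. if a = c then (U (sink G) - U (source G)) $$ (a, d) else 0)"
    using cd by simp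
  \<comment> \<open>Column c of the identity is the intensity of V in that column, so a single entry
    of the drop of U becomes a power.\<close>
  also have "\<dots> = (\<Sum>a<k. (U (sink G) - U (source G)) $$ (a, d) * 1\<^sub>m k $$ (a, c))"
    using cd by (intro sum.cong refl) auto
  also have "\<dots> = mutual_power k G U V d c"
    by (rule potential_power[OF G V potentialD(2)[OF U] cd(2,1)])
  also have "\<dots> = mutual_power k G V U c d" by (rule mutual_power_commute[OF G])
  also have "\<dots> = (\<Sum>a<k. ?R $$ (a, c) * i $$ (a, d))"
    by (rule potential_power[OF G U potentialD(2)[OF V] cd, symmetric])
  also have "\<dots> = (transpose_mat ?R * i) $$ (c, d)"
    by (rule transpose_mult_index[OF R(1) i cd, symmetric])
  finally show "(U (sink G) - U (source G)) $$ (c, d) = (transpose_mat ?R * i) $$ (c, d)" .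
qed

text \<open>Symmetry is reciprocity of the unit current with itself. The quadratic form at x is the
  energy of the current of intensity x; zero energy would mean no drop on any edge, hence no
  current, although x flows out of the sink.\<close>

lemma unit_potential_sym_pos_def:
  assumes G: "connected_network k G" and V: "potential k G (1\<^sub>m k) V"
  shows "V (sink G) - V (source G) \<in> sym_pos_def k"
proof (rule sym_pos_defI)
  let ?R = "V (sink G) - V (source G)"
  show R: "?R \<in> carrier_mat k k"
    using potentialD(2)[OF V] connected_networkD(3,4)[OF G] by (simp add: minus_carrier_mat)
  have "?R = transpose_mat ?R"
    by (rule trans[OF unit_potential_reciprocity[OF G V V]
        right_mult_one_mat[OF transpose_carrier_mat[THEN iffD2, OF R]]])
  from transpose_eq_index[OF this[symmetric] R]
  show sym: "?R $$ (i, j) = ?R $$ (j, i)" if "i < k" "j < k" for i j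
    using that .
  fix x i assume i: "i < k" "x i \<noteq> (0::real)"
  let ?D = "\<lambda>e. V (tail G e) - V (head G e)"
  note D = potential_drop_carrier[OF G V]
  \<comment> \<open>The drop along e, in component a, when the unit current is scaled by the vector
    x.\<close>
  define y where "y e a = (\<Sum>c<k. ?D e $$ (a, c) * x c)" for e a
  have Rpower: "?R $$ (c, d) = mutual_power k G V V c d" if "c < k" "d < k" for c d
  proof -
    have "mutual_power k G V V c d = (\<Sum>a<k. ?R $$ (a, c) * 1\<^sub>m k $$ (a, d))"
      by (rule potential_power[OF G V potentialD(2)[OF V] that, symmetric])
    also have "\<dots> = (\<Sum>a<k. if a = d then ?R $$ (d, c) else 0)"
      using that by (intro sum.cong refl) auto
    finally show ?thesis using that sym by simp
  qed
  have "(\<Sum>c<k. \<Sum>d<k. x c * ?R $$ (c, d) * x d) = (\<Sum>c<k. \<Sum>d<k. \<Sum>e\<in>edges G. \<Sum>a<k. \<Sum>b<k.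
      (x c * ?D e $$ (a, c)) * weight G e $$ (a, b) * (?D e $$ (b, d) * x d))"
    by (intro sum.cong refl)
      (simp add: Rpower mutual_power_def sum_distrib_left sum_distrib_right mult_ac)
  also have "\<dots> = (\<Sum>c<k. \<Sum>e\<in>edges G. \<Sum>d<k. \<Sum>a<k. \<Sum>b<k.
      (x c * ?D e $$ (a, c)) * weight G e $$ (a, b) * (?D e $$ (b, d) * x d))"
    by (intro sum.cong refl sum.swap)
  also have "\<dots> = (\<Sum>e\<in>edges G. \<Sum>c<k. \<Sum>d<k. \<Sum>a<k. \<Sum>b<k.
      (x c * ?D e $$ (a, c)) * weight G e $$ (a, b) * (?D e $$ (b, d) * x d))"
    by (rule sum.swap)
  also have "\<dots> = (\<Sum>e\<in>edges G. \<Sum>c<k. \<Sum>a<k. \<Sum>d<k. \<Sum>b<k.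
      (x c * ?D e $$ (a, c)) * weight G e $$ (a, b) * (?D e $$ (b, d) * x d))"
    by (intro sum.cong refl sum.swap)
  also have "\<dots> = (\<Sum>e\<in>edges G. \<Sum>a<k. \<Sum>c<k. \<Sum>d<k. \<Sum>b<k.
      (x c * ?D e $$ (a, c)) * weight G e $$ (a, b) * (?D e $$ (b, d) * x d))"
    by (intro sum.cong refl sum.swap)
  also have "\<dots> = (\<Sum>e\<in>edges G. \<Sum>a<k. \<Sum>c<k. \<Sum>b<k. \<Sum>d<k.
      (x c * ?D e $$ (a, c)) * weight G e $$ (a, b) * (?D e $$ (b, d) * x d))"
    by (intro sum.cong refl sum.swap)
  also have "\<dots> = (\<Sum>e\<in>edges G. \<Sum>a<k. \<Sum>b<k. \<Sum>c<k. \<Sum>d<k.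
      (x c * ?D e $$ (a, c)) * weight G e $$ (a, b) * (?D e $$ (b, d) * x d))"
    by (intro sum.cong refl sum.swap)
  also have "\<dots> = (\<Sum>e\<in>edges G. \<Sum>a<k. \<Sum>b<k. y e a * weight G e $$ (a, b) * y e b)"
    by (simp add: y_def sum_distrib_left sum_distrib_right mult_ac)
  also have "\<dots> > 0"
  proof -
    have "\<exists>e\<in>edges G. \<exists>a<k. y e a \<noteq> 0"
    proof (rule ccontr)
      assume "\<not> ?thesis"
      then have y0: "y e a = 0" if "e \<in> edges G" "a < k" for e a
        using that by blast
      \<comment> \<open>The indicator of the sink reads off the outflow there, which is x; with all
        drops zero it would vanish.\<close>
      let ?\<phi> = "\<lambda>p. if p = sink G then 1 else 0 :: real"
      have "x i = (\<Sum>c<k. if c = i then x c else 0)" using i by simp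
      also have "\<dots> = (\<Sum>c<k. (?\<phi> (sink G) - ?\<phi> (source G)) * 1\<^sub>m k $$ (i, c) * x c)"
        using i connected_networkD(5)[OF G] by (intro sum.cong refl) auto
      also have "\<dots> = (\<Sum>c<k. (\<Sum>e\<in>edges G. (?\<phi> (tail G e) - ?\<phi> (head G e)) *
          (weight G e * ?D e) $$ (i, c)) * x c)"
        using i(1) potentialD(3)[OF V i(1), of _ ?\<phi>] by (intro sum.cong refl) simp
      also have "\<dots> = (\<Sum>c<k. \<Sum>e\<in>edges G. (?\<phi> (tail G e) - ?\<phi> (head G e)) *
          ((weight G e * ?D e) $$ (i, c) * x c))"
        by (simp add: sum_distrib_right mult.assoc)
      also have "\<dots> = (\<Sum>e\<in>edges G. \<Sum>c<k. (?\<phi> (tail G e) - ?\<phi> (head G e)) *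
          ((weight G e * ?D e) $$ (i, c) * x c))"
        by (rule sum.swap)
      also have "\<dots> = (\<Sum>e\<in>edges G. (?\<phi> (tail G e) - ?\<phi> (head G e)) *
          (\<Sum>c<k. (weight G e * ?D e) $$ (i, c) * x c))"
        by (simp only: sum_distrib_left)
      also have "\<dots> = 0"
      proof (intro sum.neutral ballI)
        fix e assume e: "e \<in> edges G"
        have "(\<Sum>c<k. (weight G e * ?D e) $$ (i, c) * x c) =
            (\<Sum>c<k. \<Sum>b<k. weight G e $$ (i, b) * (?D e $$ (b, c) * x c))"
          by (intro sum.cong refl)
            (simp add: mult_mat_index[OF connected_networkD(9)[OF G e] D[OF e] i(1)]
              sum_distrib_right mult.assoc del: index_mult_mat)
        also have "\<dots> = (\<Sum>b<k. \<Sum>c<k. weight G e $$ (i, b) * (?D e $$ (b, c) * x c))"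
          by (rule sum.swap)
        also have "\<dots> = (\<Sum>b<k. weight G e $$ (i, b) * y e b)"
          by (simp only: y_def sum_distrib_left)
        also have "\<dots> = 0" by (simp add: y0[OF e])
        finally show "(?\<phi> (tail G e) - ?\<phi> (head G e)) *
            (\<Sum>c<k. (weight G e * ?D e) $$ (i, c) * x c) = 0" by simp
      qed
      finally show False using i by simp
    qed
    then show ?thesis using network_energy_pos[OF G] by blast
  qed
  finally show "(\<Sum>c<k. \<Sum>d<k. x c * ?R $$ (c, d) * x d) > 0" .
qed

text \<open>Reciprocity and symmetry make R valid for every current. Uniqueness comes from the unit
  current itself, whose intensity 1 turns the defining equation of any competitor into equality with
  R.\<close>

lemma effective_resistance_unit_potential:
  assumes G: "connected_network k G" and V: "potential k G (1\<^sub>m k) V"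
  shows "effective_resistance k G = V (sink G) - V (source G)"
  unfolding effective_resistance_def
proof (rule the_equality)
  let ?R = "V (sink G) - V (source G)"
  have R: "?R \<in> carrier_mat k k" "transpose_mat ?R = ?R"
    using unit_potential_sym_pos_def[OF G V] unfolding sym_pos_def_def by blast+
  show "?R \<in> carrier_mat k k \<and> (\<forall>i\<in>carrier_mat k k. \<forall>I U. generalized_current k G i I U \<longrightarrow>
      U (sink G) - U (source G) = ?R * i)"
  proof (intro conjI ballI allI impI)
    show "?R \<in> carrier_mat k k" by (rule R)
    fix i I U assume "i \<in> carrier_mat k k" "generalized_current k G i I U"
    from unit_potential_reciprocity[OF G V generalized_current_imp_potential[OF G this]]
    show "U (sink G) - U (source G) = ?R * i" unfolding R(2) .
  qed
  fix R' assume R': "R' \<in> carrier_mat k k \<and> (\<forall>i\<in>carrier_mat k k. \<forall>I U. generalized_current k G i I U \<longrightarrow>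
      U (sink G) - U (source G) = R' * i)"
  then have "?R = R' * 1\<^sub>m k"
    by (intro R'[THEN conjunct2, rule_format, OF one_carrier_mat potential_imp_generalized_current[OF G V]])
  also have "\<dots> = R'" by (rule right_mult_one_mat[OF R'[THEN conjunct1]])
  finally show "R' = ?R" by (rule sym)
qed

text \<open>Conductances act from the left and intensities from the right, so scaling by j commutes
  with Ohm's law.\<close>

lemma potential_mult:
  assumes G: "connected_network k G" and V: "potential k G (1\<^sub>m k) V" and j: "j \<in> carrier_mat k k"
  shows "potential k G j (\<lambda>p. V p * j)"
  unfolding potential_def
proof (intro conjI ballI allI impI)
  show "V p * j \<in> carrier_mat k k" if "p \<in> verts G" for p
    using potentialD(2)[OF V that] j by (rule mult_carrier_mat)
  fix \<phi> :: "'a \<Rightarrow> real" and a c assume ac: "a < k" "c < k"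
  let ?X = "\<lambda>e. weight G e * (V (tail G e) - V (head G e))"
  have eq: "(weight G e * (V (tail G e) * j - V (head G e) * j)) $$ (a, c) = (\<Sum>b<k. ?X e $$ (a, b) * j $$ (b, c))"
    if "e \<in> edges G" for e
  proof -
    have *: "V (tail G e) \<in> carrier_mat k k" "V (head G e) \<in> carrier_mat k k" "weight G e \<in> carrier_mat k k"
      using potentialD(2)[OF V] connected_networkD(6,7,9)[OF G that] by auto
    then have "weight G e * (V (tail G e) * j - V (head G e) * j) = ?X e * j"
      using j by (simp add: minus_mult_distrib_mat[of _ k k, symmetric] assoc_mult_mat[of _ k k _ k _ k]
          minus_carrier_mat)
    moreover have "?X e \<in> carrier_mat k k"
      using * by (intro mult_carrier_mat[of _ k k] minus_carrier_mat)
    ultimately show ?thesis using j ac by (simp add: mult_mat_index[of _ k] del: index_mult_mat)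
  qed
  have "(\<Sum>e\<in>edges G. (\<phi> (tail G e) - \<phi> (head G e)) *
      (weight G e * (V (tail G e) * j - V (head G e) * j)) $$ (a, c)) =
      (\<Sum>e\<in>edges G. \<Sum>b<k. (\<phi> (tail G e) - \<phi> (head G e)) * ?X e $$ (a, b) * j $$ (b, c))"
    by (intro sum.cong refl) (simp add: eq sum_distrib_left mult.assoc del: index_mult_mat)
  also have "\<dots> = (\<Sum>b<k. \<Sum>e\<in>edges G. (\<phi> (tail G e) - \<phi> (head G e)) * ?X e $$ (a, b) * j $$ (b, c))"
    by (rule sum.swap)
  also have "\<dots> = (\<Sum>b<k. (\<phi> (sink G) - \<phi> (source G)) * 1\<^sub>m k $$ (a, b) * j $$ (b, c))"
    using ac potentialD(3)[OF V ac(1)]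
    by (intro sum.cong refl) (simp add: sum_distrib_right[symmetric] del: index_mult_mat)
  also have "\<dots> = (\<Sum>b<k. if b = a then (\<phi> (sink G) - \<phi> (source G)) * j $$ (a, c) else 0)"
    using ac by (intro sum.cong refl) auto
  also have "\<dots> = (\<phi> (sink G) - \<phi> (source G)) * j $$ (a, c)"
    using ac by simp
  finally show "(\<Sum>e\<in>edges G. (\<phi> (tail G e) - \<phi> (head G e)) *
      (weight G e * (V (tail G e) * j - V (head G e) * j)) $$ (a, c)) =
      (\<phi> (sink G) - \<phi> (source G)) * j $$ (a, c)" .
qed (rule j)

section \<open>Gluing potentials\<close>

lemma add_diff_add_cancel_mat:
  fixes A :: "real mat"
  assumes "A \<in> carrier_mat k l" "B \<in> carrier_mat k l" "K \<in> carrier_mat k l"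
  shows "(A + K) - (B + K) = A - B"
  by (rule eq_matI) (use assms in auto)

text \<open>A test function on the glued graph is used directly on \<open>G1\<close> and pulled back
  along r on \<open>G2\<close>. The constant K raises all of \<open>V2\<close> so that the values
  match at identified nodes and leaves drops unchanged. \<open>conservation\<close> is the remaining
  balance of boundary terms.\<close>

lemma potential_glue:
  assumes G1: "connected_network k G1" and G2: "connected_network k G2" and disj: "disjoint_graphs G1 G2"
    and V1: "potential k G1 i1 V1" and V2: "potential k G2 i2 V2"
    and V: "\<And>p. p \<in> verts G1 \<Longrightarrow> V p = V1 p" "\<And>p. p \<in> verts G2 \<Longrightarrow> V (r p) = V2 p + K"
    and K: "K \<in> carrier_mat k k" and i: "i \<in> carrier_mat k k"
    and conservation: "\<And>(\<phi> :: 'v \<Rightarrow> real) a c. a < k \<Longrightarrow> c < k \<Longrightarrow>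
      (\<phi> (sink G1) - \<phi> (source G1)) * i1 $$ (a, c) + (\<phi> (r (sink G2)) - \<phi> (r (source G2))) * i2 $$ (a, c) =
      (\<phi> t - \<phi> s) * i $$ (a, c)"
  shows "potential k (glue r s t G1 G2) i (V :: 'v \<Rightarrow> real mat)"
  unfolding potential_def
proof (intro conjI ballI allI impI)
  let ?G = "glue r s t G1 G2"
  show "V p \<in> carrier_mat k k" if p: "p \<in> verts ?G" for p
  proof (cases "p \<in> verts G1")
    case True
    then show ?thesis using potentialD(2)[OF V1] V(1) by simp
  next
    case False
    with p obtain q where "q \<in> verts G2" "p = r q" by (auto simp: glue_simps)
    then show ?thesis using potentialD(2)[OF V2] V(2) K by simp
  qed
  fix \<phi> :: "'v \<Rightarrow> real" and a c assume ac: "a < k" "c < k"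
  let ?f = "\<lambda>G V e. (\<phi> (tail G e) - \<phi> (head G e)) * (weight G e * (V (tail G e) - V (head G e))) $$ (a, c)"
  have "sum (?f ?G V) (edges ?G) = sum (?f ?G V) (edges G1) + sum (?f ?G V) (edges G2)"
    unfolding glue_simps(2) using disj connected_networkD(2)[OF G1] connected_networkD(2)[OF G2]
    by (intro sum.union_disjoint) (auto simp: disjoint_graphs_def)
  also have "sum (?f ?G V) (edges G1) = sum (?f G1 V1) (edges G1)"
    by (intro sum.cong refl) (simp only: glue_simps V(1) connected_networkD(6,7)[OF G1])
  also have "\<dots> = (\<phi> (sink G1) - \<phi> (source G1)) * i1 $$ (a, c)"
    by (rule potentialD(3)[OF V1 ac])
  also have "sum (?f ?G V) (edges G2) = (\<Sum>e\<in>edges G2. (\<phi> (r (tail G2 e)) - \<phi> (r (head G2 e))) *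
      (weight G2 e * (V2 (tail G2 e) - V2 (head G2 e))) $$ (a, c))"
  proof (intro sum.cong refl)
    fix e assume e: "e \<in> edges G2"
    then have "e \<notin> edges G1" using disj by (auto simp: disjoint_graphs_def)
    moreover have "(V2 (tail G2 e) + K) - (V2 (head G2 e) + K) = V2 (tail G2 e) - V2 (head G2 e)"
      by (rule add_diff_add_cancel_mat[OF potentialD(2)[OF V2 connected_networkD(6)[OF G2 e]]
            potentialD(2)[OF V2 connected_networkD(7)[OF G2 e]] K])
    ultimately show "?f ?G V e = (\<phi> (r (tail G2 e)) - \<phi> (r (head G2 e))) *
      (weight G2 e * (V2 (tail G2 e) - V2 (head G2 e))) $$ (a, c)"
      using connected_networkD(6,7)[OF G2 e] by (simp only: glue_simps V(2) simp_thms)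
  qed
  also have "\<dots> = (\<phi> (r (sink G2)) - \<phi> (r (source G2))) * i2 $$ (a, c)"
    by (rule potentialD(3)[OF V2 ac, of "\<lambda>p. \<phi> (r p)"])
  also have "(\<phi> (sink G1) - \<phi> (source G1)) * i1 $$ (a, c) + \<dots> = (\<phi> t - \<phi> s) * i $$ (a, c)"
    by (rule conservation[OF ac])
  finally show "sum (?f ?G V) (edges ?G) = (\<phi> (sink ?G) - \<phi> (source ?G)) * i $$ (a, c)"
    unfolding glue_simps(3,4) .
qed (rule i)

section \<open>The Dirichlet Laplacian\<close>

lemma followers:
  assumes "connected_network k G"
  shows "distinct (followers G)" "set (followers G) = verts G - {source G}"
proof -
  have "\<exists>xs. distinct xs \<and> set xs = verts G - {source G}"
    using finite_distinct_list[of "verts G - {source G}"] connected_networkD(1)[OF assms] by auto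
  from someI_ex[OF this] show "distinct (followers G)" "set (followers G) = verts G - {source G}"
    by (simp_all add: followers_def)
qed

text \<open>Deleting the first k rows and columns thus becomes an index shift by k.\<close>

lemma pick_atLeast: "pick {k..} i = k + i"
proof (induction i)
  case 0
  show ?case by (auto intro: Least_equality)
next
  case (Suc i)
  then show ?case by (auto intro!: Least_equality)
qed

lemma kron_one_index:
  assumes "A \<in> carrier_mat n 1" "i < n * k" "a < k"
  shows "kron A (1\<^sub>m k) $$ (i, a) = (if i mod k = a then A $$ (i div k, 0) else (0::real))"
proof -
  have "i mod k < k" "a div k = 0" "a mod k = a" using assms(3) by simp_all
  moreover have "kron A (1\<^sub>m k) $$ (i, a) = A $$ (i div k, a div k) * 1\<^sub>m k $$ (i mod k, a mod k)"
    unfolding kron_def using assms(2,3)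
    by (subst index_mat(1)) (simp_all add: carrier_matD[OF assms(1)])
  ultimately show ?thesis using assms(3) by (simp only: index_one_mat) simp
qed

lemma kron_one_carrier:
  assumes "A \<in> carrier_mat n 1"
  shows "kron A (1\<^sub>m k) \<in> carrier_mat (n * k) k"
  by (rule carrier_matI) (simp_all add: kron_def carrier_matD[OF assms])

lemma mult_transpose_index:
  fixes M :: "'a::comm_semiring_0 mat"
  assumes "M \<in> carrier_mat r k" "K \<in> carrier_mat s k" "i < r" "j < s"
  shows "(M * transpose_mat K) $$ (i, j) = (\<Sum>b<k. M $$ (i, b) * K $$ (j, b))"
  using assms by (simp add: scalar_prod_def lessThan_atLeast0)

lemma kron_congruence_index:
  fixes A W :: "real mat"
  assumes A: "A \<in> carrier_mat n 1" and W: "W \<in> carrier_mat k k" and ij: "i < n * k" "j < n * k"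
  shows "(kron A (1\<^sub>m k) * W * transpose_mat (kron A (1\<^sub>m k))) $$ (i, j) =
    A $$ (i div k, 0) * W $$ (i mod k, j mod k) * A $$ (j div k, 0)"
proof -
  let ?K = "kron A (1\<^sub>m k)"
  note K = kron_one_carrier[OF A, of k]
  have k: "k > 0" using ij by (cases k) auto
  have KW: "?K * W \<in> carrier_mat (n * k) k" by (rule mult_carrier_mat[OF K W])
  have KW_index: "(?K * W) $$ (i, b) = A $$ (i div k, 0) * W $$ (i mod k, b)" if "b < k" for b
  proof -
    have "(?K * W) $$ (i, b) = (\<Sum>a<k. ?K $$ (i, a) * W $$ (a, b))"
      using K W ij that by (simp add: scalar_prod_def lessThan_atLeast0)
    also have "\<dots> = (\<Sum>a<k. if a = i mod k then A $$ (i div k, 0) * W $$ (i mod k, b) else 0)"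
      using ij by (intro sum.cong refl) (simp add: kron_one_index[OF A])
    finally show ?thesis using k by simp
  qed
  have "(?K * W * transpose_mat ?K) $$ (i, j) = (\<Sum>b<k. (?K * W) $$ (i, b) * ?K $$ (j, b))"
    by (rule mult_transpose_index[OF KW K ij])
  also have "\<dots> = (\<Sum>b<k. if b = j mod k then
      A $$ (i div k, 0) * W $$ (i mod k, j mod k) * A $$ (j div k, 0) else 0)"
    using ij by (intro sum.cong refl) (simp add: KW_index kron_one_index[OF A] del: index_mult_mat)
  finally show ?thesis using k by simp
qed

lemma basis_col_carrier: "basis_col vs v \<in> carrier_mat (length vs) 1"
  by (rule carrier_matI) (simp_all add: basis_col_def)

definition incidence :: "('v, 'e) tt_graph \<Rightarrow> 'e \<Rightarrow> 'v \<Rightarrow> real" where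
  "incidence G e v = (if v = tail G e then 1 else 0) - (if v = head G e then 1 else 0)"

lemma laplacian_dim:
  "dim_row (laplacian k G) = k + length (followers G) * k"
  "dim_col (laplacian k G) = k + length (followers G) * k"
  by (simp_all add: laplacian_def mat_sum_def Let_def node_list_def)

lemma card_less_atLeast: "card {i. i < k + m \<and> i \<in> {k..}} = m" for k m :: nat
proof -
  have "{i. i < k + m \<and> i \<in> {k..}} = {k..<k + m}" by auto
  then show ?thesis by simp
qed

lemma dirichlet_laplacian_carrier:
  "dirichlet_laplacian k G \<in> carrier_mat (length (followers G) * k) (length (followers G) * k)"
  by (rule carrier_matI) (simp_all only: dirichlet_laplacian_def dim_submatrix laplacian_dim card_less_atLeast)

lemma dirichlet_laplacian_index:
  assumes G: "connected_network k G" and ij: "i < length (followers G) * k" "j < length (followers G) * k"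
  shows "dirichlet_laplacian k G $$ (i, j) = (\<Sum>e\<in>edges G. incidence G e (followers G ! (i div k)) *
    weight G e $$ (i mod k, j mod k) * incidence G e (followers G ! (j div k)))"
proof -
  let ?vs = "node_list G"
  let ?n = "length ?vs"
  define d where "d e = basis_col ?vs (tail G e) - basis_col ?vs (head G e)" for e
  have k: "k > 0" using ij by (cases k) auto
  have d: "d e \<in> carrier_mat ?n 1" for e
    unfolding d_def by (rule minus_carrier_mat[OF basis_col_carrier])
  have len: "?n * k = k + length (followers G) * k" by (simp add: node_list_def)
  have ij': "k + i < ?n * k" "k + j < ?n * k" using ij by (simp_all add: len)
  \<comment> \<open>Division by k turns the shift by k into a shift by one node, which skips the
    source at the head of \<open>node_list\<close>.\<close>
  have d_index: "d e $$ ((k + i) div k, 0) = incidence G e (followers G ! (i div k))"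
    if "i < length (followers G) * k" for i e
  proof -
    have "i div k < length (followers G)" using that k by (simp add: less_mult_imp_div_less)
    then show ?thesis using k by (simp add: d_def basis_col_def incidence_def node_list_def)
  qed
  have "dirichlet_laplacian k G $$ (i, j) = laplacian k G $$ (k + i, k + j)"
    unfolding dirichlet_laplacian_def
    by (subst submatrix_index) (simp_all only: laplacian_dim card_less_atLeast ij pick_atLeast)
  also have "\<dots> = (\<Sum>e\<in>edges G. (kron (d e) (1\<^sub>m k) * weight G e * transpose_mat (kron (d e) (1\<^sub>m k))) $$ (k + i, k + j))"
    using ij' by (simp add: laplacian_def mat_sum_def Let_def d_def del: index_mult_mat)
  also have "\<dots> = (\<Sum>e\<in>edges G. incidence G e (followers G ! (i div k)) *
    weight G e $$ (i mod k, j mod k) * incidence G e (followers G ! (j div k)))"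
  proof (rule sum.cong[OF refl])
    fix e assume e: "e \<in> edges G"
    show "(kron (d e) (1\<^sub>m k) * weight G e * transpose_mat (kron (d e) (1\<^sub>m k))) $$ (k + i, k + j) =
        incidence G e (followers G ! (i div k)) * weight G e $$ (i mod k, j mod k) *
        incidence G e (followers G ! (j div k))"
      unfolding kron_congruence_index[OF d connected_networkD(9)[OF G e] ij'] d_index[OF ij(1)] d_index[OF ij(2)]
      by (simp only: mod_add_self1)
  qed
  finally show ?thesis .
qed

lemma sum_blocks:
  fixes f :: "nat \<Rightarrow> 'a::comm_monoid_add"
  shows "(\<Sum>i<n * k. f i) = (\<Sum>p<n. \<Sum>a<k. f (p * k + a))"
proof -
  have "(\<Sum>i<n * k. f i) = (\<Sum>p<n. sum f {p * k..<p * k + k})" by (rule sum.nat_group[symmetric])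
  also have "\<dots> = (\<Sum>p<n. \<Sum>a<k. f (p * k + a))"
  proof (rule sum.cong[OF refl])
    fix p
    show "sum f {p * k..<p * k + k} = (\<Sum>a<k. f (p * k + a))"
      using sum.shift_bounds_nat_ivl[of f 0 "p * k" k]
      by (simp add: add.commute[of k] add.commute[of _ "p * k"] lessThan_atLeast0)
  qed
  finally show ?thesis .
qed

text \<open>The node v may be the source: then no follower matches, and the empty sum agrees with
  the value of f there. Grounding is what allows sums over all nodes to be replaced by sums over
  followers.\<close>

lemma sum_followers:
  fixes f :: "'v \<Rightarrow> real"
  assumes G: "connected_network k G" and v: "v \<in> verts G" and "f (source G) = 0"
  shows "(\<Sum>p<length (followers G). if followers G ! p = v then f (followers G ! p) else 0) = f v"
proof -
  note F = followers[OF G]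
  have "(\<Sum>p<length (followers G). if followers G ! p = v then f (followers G ! p) else 0) =
      (\<Sum>w\<in>set (followers G). if w = v then f w else 0)"
    by (rule sum.reindex_bij_betw) (rule bij_betw_nth[OF F(1) refl refl])
  also have "\<dots> = f v" using F v assms(3) connected_networkD(1)[OF G] by auto
  finally show ?thesis .
qed

lemma sum_followers_incidence:
  fixes f :: "'v \<Rightarrow> real" and G :: "('v, 'e) tt_graph"
  assumes G: "connected_network k G" and e: "e \<in> edges G" and "f (source G) = 0"
  shows "(\<Sum>p<length (followers G). f (followers G ! p) * incidence G e (followers G ! p)) =
    f (tail G e) - f (head G e)"
proof -
  have "(\<Sum>p<length (followers G). f (followers G ! p) * incidence G e (followers G ! p)) =
    (\<Sum>p<length (followers G). (if followers G ! p = tail G e then f (followers G ! p) else 0) -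
      (if followers G ! p = head G e then f (followers G ! p) else 0))"
    by (intro sum.cong refl) (simp add: incidence_def)
  also have "\<dots> = f (tail G e) - f (head G e)"
    unfolding sum_subtractf
    by (simp only: sum_followers[where f = f, OF G connected_networkD(6)[OF G e] assms(3)]
        sum_followers[where f = f, OF G connected_networkD(7)[OF G e] assms(3)])
  finally show ?thesis .
qed

text \<open>The block vector \<open>x\<close> as a function on the nodes, extended by zero to the source.\<close>

definition node_value :: "nat \<Rightarrow> ('v, 'e) tt_graph \<Rightarrow> (nat \<Rightarrow> real) \<Rightarrow> nat \<Rightarrow> 'v \<Rightarrow> real" where
  "node_value k G x a v = (\<Sum>p<length (followers G). if followers G ! p = v then x (p * k + a) else 0)"

lemma node_value_follower:
  assumes "connected_network k G" "p < length (followers G)"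
  shows "node_value k G x a (followers G ! p) = x (p * k + a)"
proof -
  have "node_value k G x a (followers G ! p) =
      (\<Sum>q<length (followers G). if q = p then x (p * k + a) else 0)"
    unfolding node_value_def using assms(2) followers(1)[OF assms(1)]
    by (intro sum.cong refl) (auto simp: nth_eq_iff_index_eq)
  then show ?thesis using assms(2) by simp
qed

lemma node_value_source:
  assumes "connected_network k G"
  shows "node_value k G x a (source G) = 0"
  unfolding node_value_def
proof (intro sum.neutral ballI)
  fix p assume "p \<in> {..<length (followers G)}"
  then have "followers G ! p \<in> set (followers G)" by simp
  then show "(if followers G ! p = source G then x (p * k + a) else 0) = 0"
    using followers(2)[OF assms] by auto
qed

lemma sum_incidence_node_value:
  assumes G: "connected_network k G" and e: "e \<in> edges G"
  shows "(\<Sum>p<length (followers G). incidence G e (followers G ! p) * x (p * k + a)) =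
    node_value k G x a (tail G e) - node_value k G x a (head G e)"
proof -
  have "(\<Sum>p<length (followers G). incidence G e (followers G ! p) * x (p * k + a)) =
      (\<Sum>p<length (followers G). node_value k G x a (followers G ! p) * incidence G e (followers G ! p))"
    by (intro sum.cong refl) (simp add: node_value_follower[OF G])
  also have "\<dots> = node_value k G x a (tail G e) - node_value k G x a (head G e)"
    by (rule sum_followers_incidence[where f = "node_value k G x a", OF G e node_value_source[OF G]])
  finally show ?thesis .
qed

text \<open>The right-hand side is component a of the net outflow at follower p, for the current
  driven by the potential x grounded at the source.\<close>

lemma dirichlet_laplacian_apply:
  assumes G: "connected_network k G" and p: "p < length (followers G)" and a: "a < k"
  shows "(\<Sum>j<length (followers G) * k. dirichlet_laplacian k G $$ (p * k + a, j) * x j) =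
    (\<Sum>e\<in>edges G. incidence G e (followers G ! p) * (\<Sum>b<k. weight G e $$ (a, b) *
      (node_value k G x b (tail G e) - node_value k G x b (head G e))))"
proof -
  let ?F = "followers G"
  have block: "q * k + b < length ?F * k \<and> (q * k + b) div k = q \<and> (q * k + b) mod k = b"
    if "q < length ?F" "b < k" for q b
  proof -
    have "q * k + b < Suc q * k" using that by simp
    also have "\<dots> \<le> length ?F * k" using that by (intro mult_le_mono1) simp
    finally show ?thesis using that by simp
  qed
  have "(\<Sum>j<length ?F * k. dirichlet_laplacian k G $$ (p * k + a, j) * x j) =
      (\<Sum>q<length ?F. \<Sum>b<k. dirichlet_laplacian k G $$ (p * k + a, q * k + b) * x (q * k + b))"
    by (rule sum_blocks)
  also have "\<dots> = (\<Sum>q<length ?F. \<Sum>b<k. \<Sum>e\<in>edges G. incidence G e (?F ! p) * (weight G e $$ (a, b) *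
      (incidence G e (?F ! q) * x (q * k + b))))"
    using block block[OF p a]
    by (intro sum.cong refl) (simp add: dirichlet_laplacian_index[OF G] sum_distrib_left mult_ac)
  also have "\<dots> = (\<Sum>b<k. \<Sum>q<length ?F. \<Sum>e\<in>edges G. incidence G e (?F ! p) * (weight G e $$ (a, b) *
      (incidence G e (?F ! q) * x (q * k + b))))"
    by (rule sum.swap)
  also have "\<dots> = (\<Sum>b<k. \<Sum>e\<in>edges G. \<Sum>q<length ?F. incidence G e (?F ! p) * (weight G e $$ (a, b) *
      (incidence G e (?F ! q) * x (q * k + b))))"
    by (intro sum.cong refl sum.swap)
  also have "\<dots> = (\<Sum>e\<in>edges G. \<Sum>b<k. \<Sum>q<length ?F. incidence G e (?F ! p) * (weight G e $$ (a, b) *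
      (incidence G e (?F ! q) * x (q * k + b))))"
    by (rule sum.swap)
  also have "\<dots> = (\<Sum>e\<in>edges G. incidence G e (?F ! p) * (\<Sum>b<k. weight G e $$ (a, b) *
      (\<Sum>q<length ?F. incidence G e (?F ! q) * x (q * k + b))))"
    by (simp only: sum_distrib_left)
  also have "\<dots> = (\<Sum>e\<in>edges G. incidence G e (?F ! p) * (\<Sum>b<k. weight G e $$ (a, b) *
      (node_value k G x b (tail G e) - node_value k G x b (head G e))))"
    by (intro sum.cong refl) (simp only: sum_incidence_node_value[OF G])
  finally show ?thesis .
qed

text \<open>The quadratic form is the energy of the grounded potential x. A nonzero entry gives a
  node whose value differs from the value 0 at the source, and connectedness then provides an edge
  with a nonzero drop.\<close>

lemma dirichlet_laplacian_sym_pos_def: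
  assumes G: "connected_network k G"
  shows "dirichlet_laplacian k G \<in> sym_pos_def (length (followers G) * k)"
proof (rule sym_pos_defI[OF dirichlet_laplacian_carrier])
  let ?F = "followers G"
  let ?A = "dirichlet_laplacian k G"
  let ?n = "length ?F * k"
  show "?A $$ (i, j) = ?A $$ (j, i)" if ij: "i < ?n" "j < ?n" for i j
  proof -
    have "k > 0" using ij by (cases k) auto
    then show ?thesis
      unfolding dirichlet_laplacian_index[OF G ij] dirichlet_laplacian_index[OF G ij(2,1)]
      by (intro sum.cong refl)
        (simp add: sym_pos_def_sym[OF connected_networkD(8)[OF G], of _ "i mod k" "j mod k"])
  qed
  fix x i assume i: "i < ?n" "x i \<noteq> (0::real)"
  have k: "k > 0" using i by (cases k) auto
  let ?u = "\<lambda>b e. node_value k G x b (tail G e) - node_value k G x b (head G e)"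
  have "(\<Sum>i<?n. \<Sum>j<?n. x i * ?A $$ (i, j) * x j) = (\<Sum>i<?n. x i * (\<Sum>j<?n. ?A $$ (i, j) * x j))"
    by (simp only: sum_distrib_left mult.assoc)
  also have "\<dots> = (\<Sum>p<length ?F. \<Sum>a<k. x (p * k + a) * (\<Sum>j<?n. ?A $$ (p * k + a, j) * x j))"
    by (rule sum_blocks)
  also have "\<dots> = (\<Sum>p<length ?F. \<Sum>a<k. \<Sum>e\<in>edges G. incidence G e (?F ! p) * x (p * k + a) *
      (\<Sum>b<k. weight G e $$ (a, b) * ?u b e))"
    by (intro sum.cong refl, simp only: dirichlet_laplacian_apply[OF G] lessThan_iff)
      (simp only: sum_distrib_left mult_ac)
  also have "\<dots> = (\<Sum>a<k. \<Sum>p<length ?F. \<Sum>e\<in>edges G. incidence G e (?F ! p) * x (p * k + a) *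
      (\<Sum>b<k. weight G e $$ (a, b) * ?u b e))"
    by (rule sum.swap)
  also have "\<dots> = (\<Sum>a<k. \<Sum>e\<in>edges G. \<Sum>p<length ?F. incidence G e (?F ! p) * x (p * k + a) *
      (\<Sum>b<k. weight G e $$ (a, b) * ?u b e))"
    by (intro sum.cong refl sum.swap)
  also have "\<dots> = (\<Sum>e\<in>edges G. \<Sum>a<k. \<Sum>p<length ?F. incidence G e (?F ! p) * x (p * k + a) *
      (\<Sum>b<k. weight G e $$ (a, b) * ?u b e))"
    by (rule sum.swap)
  also have "\<dots> = (\<Sum>e\<in>edges G. \<Sum>a<k. (\<Sum>p<length ?F. incidence G e (?F ! p) * x (p * k + a)) *
      (\<Sum>b<k. weight G e $$ (a, b) * ?u b e))"
    by (simp only: sum_distrib_right)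
  also have "\<dots> = (\<Sum>e\<in>edges G. \<Sum>a<k. \<Sum>b<k. ?u a e * weight G e $$ (a, b) * ?u b e)"
    by (intro sum.cong refl) (simp only: sum_incidence_node_value[OF G] sum_distrib_left mult.assoc)
  also have "\<dots> > 0"
  proof -
    have p: "i div k < length ?F" using i by (simp add: less_mult_imp_div_less)
    have "node_value k G x (i mod k) (?F ! (i div k)) \<noteq> node_value k G x (i mod k) (source G)"
      unfolding node_value_follower[OF G p] node_value_source[OF G] using i(2) by simp
    moreover have "?F ! (i div k) \<in> verts G"
      using nth_mem[OF p] followers(2)[OF G] by auto
    ultimately obtain e where "e \<in> edges G" "?u (i mod k) e \<noteq> 0"
      using connected_network_constant[OF G, of "node_value k G x (i mod k)" "?F ! (i div k)"] by auto
    from network_energy_pos[where y = "\<lambda>e a. ?u a e", OF G this(1) _ this(2)] k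
    show ?thesis by simp
  qed
  finally show "(\<Sum>i<?n. \<Sum>j<?n. x i * ?A $$ (i, j) * x j) > 0" .
qed

lemma sink_input_carrier: "sink_input k G \<in> carrier_mat (length (followers G) * k) k"
  unfolding sink_input_def by (rule kron_one_carrier[OF basis_col_carrier])

lemma sink_input_index:
  assumes "p < length (followers G)" "a < k" "c < k"
  shows "sink_input k G $$ (p * k + a, c) = (if a = c \<and> followers G ! p = sink G then 1 else 0)"
proof -
  have "p * k + a < Suc p * k" using assms by simp
  also have "\<dots> \<le> length (followers G) * k" using assms by (intro mult_le_mono1) simp
  finally have "p * k + a < length (followers G) * k" .
  with assms show ?thesis
    unfolding sink_input_def by (simp add: kron_one_index[OF basis_col_carrier]) (simp add: basis_col_def)
qed

text \<open>The grounded system expresses Kirchhoff's law at the followers only. The law at the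
  source follows because adding a constant to a test function changes no difference along an
  edge.\<close>

lemma unit_potential_dirichlet:
  assumes G: "connected_network k G"
  obtains V where "potential k G (1\<^sub>m k) V"
    "V (sink G) - V (source G) =
       transpose_mat (sink_input k G) * mat_inv (dirichlet_laplacian k G) * sink_input k G"
proof -
  let ?F = "followers G"
  let ?A = "dirichlet_laplacian k G"
  let ?B = "sink_input k G"
  let ?n = "length ?F * k"
  note A = dirichlet_laplacian_carrier[of k G]
  note B = sink_input_carrier[of k G]
  note Ai = sym_pos_def_mat_inv[OF dirichlet_laplacian_sym_pos_def[OF G]]
  define X where "X = mat_inv ?A * ?B"
  have X: "X \<in> carrier_mat ?n k" unfolding X_def by (rule mult_carrier_mat[OF Ai(1) B])
  have AX: "?A * X = ?B"
    unfolding X_def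
    by (simp only: assoc_mult_mat[OF A Ai(1) B, symmetric] Ai(2) left_mult_one_mat[OF B])
  define V where "V v = Matrix.mat k k (\<lambda>(a, c). node_value k G (\<lambda>i. X $$ (i, c)) a v)" for v
  have V: "V v \<in> carrier_mat k k" for v by (simp add: V_def)
  have block: "q * k + b < ?n" if "q < length ?F" "b < k" for q b
  proof -
    have "q * k + b < Suc q * k" using that by simp
    also have "\<dots> \<le> ?n" using that by (intro mult_le_mono1) simp
    finally show ?thesis .
  qed
  have flow: "(\<Sum>e\<in>edges G. incidence G e (?F ! p) * (weight G e * (V (tail G e) - V (head G e))) $$ (a, c)) =
      (if a = c \<and> ?F ! p = sink G then 1 else 0)"
    if p: "p < length ?F" and ac: "a < k" "c < k" for p a c
  proof -
    have "(weight G e * (V (tail G e) - V (head G e))) $$ (a, c) = (\<Sum>b<k. weight G e $$ (a, b) *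
        (node_value k G (\<lambda>i. X $$ (i, c)) b (tail G e) - node_value k G (\<lambda>i. X $$ (i, c)) b (head G e)))"
      if e: "e \<in> edges G" for e
      unfolding mult_mat_index[OF connected_networkD(9)[OF G e] minus_carrier_mat[OF V] ac]
      using ac by (intro sum.cong refl) (simp add: V_def)
    then have "(\<Sum>e\<in>edges G. incidence G e (?F ! p) * (weight G e * (V (tail G e) - V (head G e))) $$ (a, c)) =
        (\<Sum>j<?n. ?A $$ (p * k + a, j) * X $$ (j, c))"
      unfolding dirichlet_laplacian_apply[OF G p ac(1)] by (intro sum.cong refl) (simp only:)
    also have "\<dots> = (?A * X) $$ (p * k + a, c)"
      using A X block[OF p ac(1)] ac by (simp add: scalar_prod_def lessThan_atLeast0)
    finally show ?thesis unfolding AX sink_input_index[OF p ac] .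
  qed
  have "potential k G (1\<^sub>m k) V"
    unfolding potential_def
  proof (intro conjI ballI allI impI)
    fix \<phi> :: "'a \<Rightarrow> real" and a c assume ac: "a < k" "c < k"
    let ?I = "\<lambda>e. (weight G e * (V (tail G e) - V (head G e))) $$ (a, c)"
    \<comment> \<open>Normalizing the test function to vanish at the source lets its edge
      differences be expanded over the followers, where \<open>flow\<close> applies.\<close>
    define \<psi> where "\<psi> v = \<phi> v - \<phi> (source G)" for v
    have \<psi>: "\<psi> (source G) = 0" by (simp add: \<psi>_def)
    have "(\<Sum>e\<in>edges G. (\<phi> (tail G e) - \<phi> (head G e)) * ?I e) =
        (\<Sum>e\<in>edges G. (\<Sum>p<length ?F. \<psi> (?F ! p) * incidence G e (?F ! p)) * ?I e)"
    proof (rule sum.cong[OF refl])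
      fix e assume e: "e \<in> edges G"
      have "\<phi> (tail G e) - \<phi> (head G e) = \<psi> (tail G e) - \<psi> (head G e)" by (simp add: \<psi>_def)
      then show "(\<phi> (tail G e) - \<phi> (head G e)) * ?I e =
          (\<Sum>p<length ?F. \<psi> (?F ! p) * incidence G e (?F ! p)) * ?I e"
        by (simp only: sum_followers_incidence[where f = \<psi>, OF G e \<psi>])
    qed
    also have "\<dots> = (\<Sum>e\<in>edges G. \<Sum>p<length ?F. \<psi> (?F ! p) * (incidence G e (?F ! p) * ?I e))"
      by (simp only: sum_distrib_right mult.assoc)
    also have "\<dots> = (\<Sum>p<length ?F. \<Sum>e\<in>edges G. \<psi> (?F ! p) * (incidence G e (?F ! p) * ?I e))"
      by (rule sum.swap)
    also have "\<dots> = (\<Sum>p<length ?F. \<psi> (?F ! p) * (\<Sum>e\<in>edges G. incidence G e (?F ! p) * ?I e))"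
      by (simp only: sum_distrib_left)
    also have "\<dots> = (\<Sum>p<length ?F. \<psi> (?F ! p) * (if a = c \<and> ?F ! p = sink G then 1 else 0))"
      by (intro sum.cong refl) (simp only: flow[OF _ ac] lessThan_iff)
    also have "\<dots> = (if a = c then \<Sum>p<length ?F. if ?F ! p = sink G then \<psi> (?F ! p) else 0 else 0)"
      by (cases "a = c") (simp_all add: if_distrib[of "\<lambda>x. _ * x"] cong: if_cong)
    also have "\<dots> = (\<phi> (sink G) - \<phi> (source G)) * 1\<^sub>m k $$ (a, c)"
      unfolding sum_followers[where f = \<psi>, OF G connected_networkD(4)[OF G] \<psi>] using ac by (simp add: \<psi>_def)
    finally show "(\<Sum>e\<in>edges G. (\<phi> (tail G e) - \<phi> (head G e)) * ?I e) =
        (\<phi> (sink G) - \<phi> (source G)) * 1\<^sub>m k $$ (a, c)" .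
  qed (use V in simp_all)
  moreover have "V (sink G) - V (source G) = transpose_mat ?B * mat_inv ?A * ?B"
  proof -
    have "V (sink G) - V (source G) = V (sink G)"
      by (rule eq_matI) (simp_all add: V_def node_value_source[OF G])
    also have "\<dots> = transpose_mat ?B * X"
    proof (rule eq_matI)
      have BX: "transpose_mat ?B * X \<in> carrier_mat k k"
        by (rule mult_carrier_mat[OF transpose_carrier_mat[THEN iffD2, OF B] X])
      show "dim_row (V (sink G)) = dim_row (transpose_mat ?B * X)"
        "dim_col (V (sink G)) = dim_col (transpose_mat ?B * X)"
        unfolding carrier_matD[OF BX] carrier_matD[OF V] by (rule refl)+
      fix a c assume "a < dim_row (transpose_mat ?B * X)" "c < dim_col (transpose_mat ?B * X)"
      then have ac: "a < k" "c < k" unfolding carrier_matD[OF BX] .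
      have "(transpose_mat ?B * X) $$ (a, c) = (\<Sum>i<?n. ?B $$ (i, a) * X $$ (i, c))"
        using B X ac by (simp add: scalar_prod_def lessThan_atLeast0)
      also have "\<dots> = (\<Sum>p<length ?F. \<Sum>b<k. ?B $$ (p * k + b, a) * X $$ (p * k + b, c))"
        by (rule sum_blocks)
      also have "\<dots> = (\<Sum>p<length ?F. \<Sum>b<k. if b = a then
          if ?F ! p = sink G then X $$ (p * k + a, c) else 0 else 0)"
        by (intro sum.cong refl) (simp add: sink_input_index ac)
      also have "\<dots> = V (sink G) $$ (a, c)"
        using ac by (simp add: V_def node_value_def)
      finally show "V (sink G) $$ (a, c) = (transpose_mat ?B * X) $$ (a, c)" by simp
    qed
    also have "\<dots> = transpose_mat ?B * mat_inv ?A * ?B"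
      unfolding X_def
      by (rule assoc_mult_mat[OF transpose_carrier_mat[THEN iffD2, OF B] Ai(1) B, symmetric])
    finally show ?thesis .
  qed
  ultimately show thesis by (rule that)
qed

section \<open>Traces of parallel sums\<close>

lemma mat_trace_sym_pos_def_pos:
  assumes A: "A \<in> sym_pos_def k" and k: "k \<ge> 1"
  shows "mat_trace A > 0"
proof -
  have "A $$ (i, i) > 0" if i: "i < k" for i
  proof -
    let ?x = "\<lambda>j. if j = i then 1 else 0 :: real"
    have "(\<Sum>l<k. \<Sum>j<k. ?x l * A $$ (l, j) * ?x j) = (\<Sum>l<k. if l = i then A $$ (i, i) else 0)"
    proof (intro sum.cong refl)
      fix l
      have "(\<Sum>j<k. ?x l * A $$ (l, j) * ?x j) = (\<Sum>j<k. if j = i then ?x l * A $$ (l, i) else 0)"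
        by (intro sum.cong refl) simp
      then show "(\<Sum>j<k. ?x l * A $$ (l, j) * ?x j) = (if l = i then A $$ (i, i) else 0)"
        using i by simp
    qed
    then show ?thesis using sym_pos_def_quadratic[OF A i, of ?x] i by simp
  qed
  moreover have "dim_row A = k" using A by (auto simp: sym_pos_def_def)
  moreover have "{..<k} \<noteq> {}" using k by (auto simp: lessThan_empty_iff)
  ultimately show ?thesis unfolding mat_trace_def by (intro sum_pos) auto
qed

lemma sym_pos_def_add:
  assumes A: "A \<in> sym_pos_def k" and B: "B \<in> sym_pos_def k"
  shows "A + B \<in> sym_pos_def k"
proof (rule sym_pos_defI)
  have c: "A \<in> carrier_mat k k" "B \<in> carrier_mat k k"
    using A B by (simp_all add: sym_pos_def_def)
  then show "A + B \<in> carrier_mat k k" by simp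
  show "(A + B) $$ (i, j) = (A + B) $$ (j, i)" if "i < k" "j < k" for i j
    using that c sym_pos_def_sym[OF A that] sym_pos_def_sym[OF B that] by simp
  fix x i assume i: "i < k" "x i \<noteq> (0::real)"
  have "(\<Sum>i<k. \<Sum>j<k. x i * (A + B) $$ (i, j) * x j) =
      (\<Sum>i<k. \<Sum>j<k. x i * A $$ (i, j) * x j) + (\<Sum>i<k. \<Sum>j<k. x i * B $$ (i, j) * x j)"
    unfolding sum.distrib[symmetric] using c by (intro sum.cong refl) (simp add: algebra_simps)
  with sym_pos_def_quadratic[where x = x, OF A i] sym_pos_def_quadratic[where x = x, OF B i]
  show "(\<Sum>i<k. \<Sum>j<k. x i * (A + B) $$ (i, j) * x j) > 0" by linarith
qed

text \<open>The parallel sum of \<open>R1\<close> and \<open>R2\<close> splits a unit current into the optimal portions \<open>a\<close>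
  and \<open>1 - a\<close>. Comparing with the suboptimal scalar portions \<open>\<alpha>\<close> and \<open>1 - \<alpha>\<close>, the excess
  energy is the quadratic form of \<open>R1 + R2\<close> at \<open>a - \<alpha>\<close>.\<close>

lemma mat_trace_parallel_sum:
  assumes k: "k \<ge> 1" and R1: "R1 \<in> sym_pos_def k" and R2: "R2 \<in> sym_pos_def k"
    and a: "a \<in> carrier_mat k k" and split: "(R1 + R2) * a = R2"
  shows "mat_trace (R1 * a) \<le> par_sum (mat_trace R1) (mat_trace R2)"
    and "mat_trace (R1 * a) = par_sum (mat_trace R1) (mat_trace R2) \<longleftrightarrow> (\<exists>c>0. R1 = c \<cdot>\<^sub>m R2)"
proof -
  note S = sym_pos_def_add[OF R1 R2]
  have c: "R1 \<in> carrier_mat k k" "R2 \<in> carrier_mat k k" "R1 + R2 \<in> carrier_mat k k"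
    using R1 R2 by (simp_all add: sym_pos_def_def)
  define s where "s i j = R1 $$ (i, j) + R2 $$ (i, j)" for i j
  have S_index: "(R1 + R2) $$ (i, j) = s i j" if "i < k" "j < k" for i j
    using that c by (simp add: s_def)
  have s_sym: "s i j = s j i" if "i < k" "j < k" for i j
    using sym_pos_def_sym[OF R1 that] sym_pos_def_sym[OF R2 that] by (simp add: s_def)
  have sa: "(\<Sum>j<k. s i j * a $$ (j, l)) = R2 $$ (i, l)" if "i < k" "l < k" for i l
  proof -
    have "R2 $$ (i, l) = ((R1 + R2) * a) $$ (i, l)" by (simp only: split)
    also have "\<dots> = (\<Sum>j<k. (R1 + R2) $$ (i, j) * a $$ (j, l))"
      by (rule mult_mat_index[OF c(3) a that])
    finally show ?thesis using that by (simp add: S_index)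
  qed
  define T1 T2 Z where "T1 = mat_trace R1" and "T2 = mat_trace R2" and "Z = mat_trace (R1 * a)"
  have T: "T1 > 0" "T2 > 0"
    unfolding T1_def T2_def using mat_trace_sym_pos_def_pos[OF R1 k] mat_trace_sym_pos_def_pos[OF R2 k] .
  have T1: "T1 = (\<Sum>i<k. R1 $$ (i, i))" and T2: "T2 = (\<Sum>i<k. R2 $$ (i, i))"
    using c by (simp_all add: T1_def T2_def mat_trace_def)
  have Z: "Z = (\<Sum>l<k. \<Sum>i<k. R1 $$ (l, i) * a $$ (i, l))"
    unfolding Z_def mat_trace_def using c a by (simp add: scalar_prod_def lessThan_atLeast0)
  \<comment> \<open>The minimizer of \<alpha>^2 \<open>T1\<close> + (1 - \<alpha>)^2
    \<open>T2\<close>, the energy of a scalar split; the minimum is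
    \<open>T1 * T2 / (T1 + T2)\<close>.\<close>
  define \<alpha> where "\<alpha> = T2 / (T1 + T2)"
  define D where "D i l = a $$ (i, l) - (if i = l then \<alpha> else 0)" for i l
  \<comment> \<open>Applying \<open>R1 + R2\<close> to D = a - \<alpha> eliminates a by the split
    equation, so the quadratic expression E becomes linear in a.\<close>
  have sD: "(\<Sum>j<k. s i j * D j l) = R2 $$ (i, l) - \<alpha> * s i l" if "i < k" "l < k" for i l
  proof -
    have "(\<Sum>j<k. s i j * D j l) = (\<Sum>j<k. s i j * a $$ (j, l)) - (\<Sum>j<k. if j = l then \<alpha> * s i l else 0)"
      unfolding sum_subtractf[symmetric] by (intro sum.cong refl) (simp add: D_def algebra_simps)
    then show ?thesis using that by (simp add: sa)
  qed
  define E where "E = (\<Sum>l<k. \<Sum>i<k. \<Sum>j<k. D i l * (R1 + R2) $$ (i, j) * D j l)"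
  have E: "E = (\<Sum>l<k. \<Sum>i<k. D i l * (R2 $$ (i, l) - \<alpha> * s i l))"
    unfolding E_def
  proof (intro sum.cong refl)
    fix l i assume "l \<in> {..<k}" "i \<in> {..<k}"
    then have il: "i < k" "l < k" by auto
    have "(\<Sum>j<k. D i l * (R1 + R2) $$ (i, j) * D j l) = D i l * (\<Sum>j<k. s i j * D j l)"
      unfolding sum_distrib_left using il by (intro sum.cong refl) (simp only: S_index lessThan_iff mult.assoc)
    then show "(\<Sum>j<k. D i l * (R1 + R2) $$ (i, j) * D j l) = D i l * (R2 $$ (i, l) - \<alpha> * s i l)"
      by (simp only: sD[OF il])
  qed
  have "E = (\<Sum>l<k. (\<Sum>i<k. R2 $$ (l, i) * a $$ (i, l)) - \<alpha> * (\<Sum>i<k. s l i * a $$ (i, l)) -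
      \<alpha> * (R2 $$ (l, l) - \<alpha> * s l l))"
    unfolding E
  proof (intro sum.cong refl)
    fix l assume "l \<in> {..<k}"
    then have l: "l < k" by simp
    have "(\<Sum>i<k. D i l * (R2 $$ (i, l) - \<alpha> * s i l)) =
        (\<Sum>i<k. R2 $$ (l, i) * a $$ (i, l) - \<alpha> * (s l i * a $$ (i, l)) -
          (if i = l then \<alpha> * (R2 $$ (l, l) - \<alpha> * s l l) else 0))"
    proof (rule sum.cong[OF refl])
      fix i assume "i \<in> {..<k}"
      then have i: "i < k" by simp
      show "D i l * (R2 $$ (i, l) - \<alpha> * s i l) = R2 $$ (l, i) * a $$ (i, l) - \<alpha> * (s l i * a $$ (i, l)) -
          (if i = l then \<alpha> * (R2 $$ (l, l) - \<alpha> * s l l) else 0)"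
        unfolding s_sym[OF i l] sym_pos_def_sym[OF R2 i l] by (simp add: D_def algebra_simps)
    qed
    also have "\<dots> = (\<Sum>i<k. R2 $$ (l, i) * a $$ (i, l)) - \<alpha> * (\<Sum>i<k. s l i * a $$ (i, l)) -
        \<alpha> * (R2 $$ (l, l) - \<alpha> * s l l)"
      using l by (simp add: sum_subtractf sum_distrib_left)
    finally show "(\<Sum>i<k. D i l * (R2 $$ (i, l) - \<alpha> * s i l)) =
        (\<Sum>i<k. R2 $$ (l, i) * a $$ (i, l)) - \<alpha> * (\<Sum>i<k. s l i * a $$ (i, l)) -
        \<alpha> * (R2 $$ (l, l) - \<alpha> * s l l)" .
  qed
  \<comment> \<open>The split equation replaces \<open>R2 * a\<close> by \<open>R2 - R1 * a\<close>
    and \<open>(R1 + R2) * a\<close> by \<open>R2\<close>, so a survives only in the trace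
    Z.\<close>
  also have "\<dots> = (\<Sum>l<k. (R2 $$ (l, l) - (\<Sum>i<k. R1 $$ (l, i) * a $$ (i, l))) - \<alpha> * R2 $$ (l, l) -
      \<alpha> * (R2 $$ (l, l) - \<alpha> * s l l))"
  proof (intro sum.cong refl)
    fix l assume "l \<in> {..<k}"
    then have l: "l < k" by simp
    have "(\<Sum>i<k. R2 $$ (l, i) * a $$ (i, l)) = (\<Sum>i<k. s l i * a $$ (i, l)) - (\<Sum>i<k. R1 $$ (l, i) * a $$ (i, l))"
      unfolding sum_subtractf[symmetric] by (intro sum.cong refl) (simp add: s_def algebra_simps)
    then show "(\<Sum>i<k. R2 $$ (l, i) * a $$ (i, l)) - \<alpha> * (\<Sum>i<k. s l i * a $$ (i, l)) -
        \<alpha> * (R2 $$ (l, l) - \<alpha> * s l l) = (R2 $$ (l, l) - (\<Sum>i<k. R1 $$ (l, i) * a $$ (i, l))) -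
        \<alpha> * R2 $$ (l, l) - \<alpha> * (R2 $$ (l, l) - \<alpha> * s l l)"
      by (simp only: sa[OF l l])
  qed
  also have "\<dots> = (T2 - Z) - \<alpha> * T2 - \<alpha> * (T2 - \<alpha> * (T1 + T2))"
    by (simp add: T1 T2 Z s_def sum_subtractf sum.distrib sum_distrib_left algebra_simps)
  also have "\<dots> = T1 * T2 / (T1 + T2) - Z"
    using T by (simp add: \<alpha>_def field_simps)
  finally have Z_E: "Z = par_sum T1 T2 - E" by (simp add: par_sum_def)
  have E_l: "(\<Sum>i<k. \<Sum>j<k. D i l * (R1 + R2) $$ (i, j) * D j l) \<ge> 0" for l
    by (rule sym_pos_def_quadratic_nonneg[OF S])
  have E_nonneg: "E \<ge> 0" unfolding E_def by (rule sum_nonneg) (rule E_l)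
  \<comment> \<open>Definiteness, column by column, turns E = 0 into D = 0, that is, a is the scalar
    \<alpha>; applying \<open>R1 + R2\<close> gives the stated proportionality.\<close>
  have E_0: "E = 0 \<longleftrightarrow> (\<forall>i<k. \<forall>l<k. R2 $$ (i, l) = \<alpha> * s i l)"
  proof
    assume 0: "E = 0"
    have "(\<Sum>i<k. \<Sum>j<k. D i l * (R1 + R2) $$ (i, j) * D j l) = 0" if "l < k" for l
      by (rule sum_nonneg_0[OF finite_lessThan[of k] E_l 0[unfolded E_def]]) (simp add: that)
    then have "D i l = 0" if "i < k" "l < k" for i l
      using sym_pos_def_quadratic[where x = "\<lambda>i. D i l", OF S that(1)] that(2) by fastforce
    with sD show "\<forall>i<k. \<forall>l<k. R2 $$ (i, l) = \<alpha> * s i l" by simp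
  next
    assume "\<forall>i<k. \<forall>l<k. R2 $$ (i, l) = \<alpha> * s i l"
    then show "E = 0" unfolding E by simp
  qed
  \<comment> \<open>Taking traces forces the factor to be \<open>T1 / T2\<close>, which is also the
    ratio belonging to \<alpha>.\<close>
  have "(\<forall>i<k. \<forall>l<k. R2 $$ (i, l) = \<alpha> * s i l) \<longleftrightarrow> (\<exists>c>0. R1 = c \<cdot>\<^sub>m R2)"
  proof
    assume *: "\<forall>i<k. \<forall>l<k. R2 $$ (i, l) = \<alpha> * s i l"
    have "R1 $$ (i, l) = T1 / T2 * R2 $$ (i, l)" if "i < k" "l < k" for i l
    proof -
      have "R2 $$ (i, l) = T2 / (T1 + T2) * (R1 $$ (i, l) + R2 $$ (i, l))"
        using * that by (simp add: s_def \<alpha>_def)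
      then have "R2 $$ (i, l) * (T1 + T2) = T2 * (R1 $$ (i, l) + R2 $$ (i, l))"
        using T by (simp add: field_simps)
      then have "T2 * R1 $$ (i, l) = T1 * R2 $$ (i, l)" by (simp add: algebra_simps)
      then show ?thesis using T by (simp add: field_simps)
    qed
    then have "R1 = (T1 / T2) \<cdot>\<^sub>m R2"
      using c by (intro eq_matI) auto
    then show "\<exists>c>0. R1 = c \<cdot>\<^sub>m R2" using T by (intro exI[of _ "T1 / T2"]) simp
  next
    assume "\<exists>c>0. R1 = c \<cdot>\<^sub>m R2"
    then obtain r where r: "r > 0" "R1 = r \<cdot>\<^sub>m R2" by auto
    have R1_index: "R1 $$ (i, l) = r * R2 $$ (i, l)" if "i < k" "l < k" for i l
      using that c(2) unfolding r(2) by simp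
    then have "T1 = r * T2" by (simp add: T1 T2 sum_distrib_left)
    then have "T2 * (r + 1) = T1 + T2" by (simp add: algebra_simps)
    then have \<alpha>: "\<alpha> * (r + 1) = 1" using T by (simp add: \<alpha>_def)
    show "\<forall>i<k. \<forall>l<k. R2 $$ (i, l) = \<alpha> * s i l"
    proof (intro allI impI)
      fix i l assume "i < k" "l < k"
      then have "\<alpha> * s i l = \<alpha> * (r + 1) * R2 $$ (i, l)"
        by (simp add: s_def R1_index algebra_simps)
      then show "R2 $$ (i, l) = \<alpha> * s i l" by (simp add: \<alpha>)
    qed
  qed
  with E_0 Z_E E_nonneg
  show "mat_trace (R1 * a) \<le> par_sum (mat_trace R1) (mat_trace R2)"
    and "mat_trace (R1 * a) = par_sum (mat_trace R1) (mat_trace R2) \<longleftrightarrow> (\<exists>c>0. R1 = c \<cdot>\<^sub>m R2)"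
    unfolding T1_def T2_def Z_def by auto
qed

section \<open>Series and parallel joins\<close>

lemma consensus_h2_connected_network:
  assumes G: "connected_network k G"
  shows "(consensus_h2 k G)\<^sup>2 = 1 / 2 * mat_trace (transpose_mat (sink_input k G) *
      mat_inv (dirichlet_laplacian k G) * sink_input k G)"
  unfolding consensus_h2_def Let_def carrier_matD(1)[OF dirichlet_laplacian_carrier]
  by (rule h2_norm_sym_pos_def[OF dirichlet_laplacian_sym_pos_def[OF G] sink_input_carrier])

lemma consensus_h2_effective_resistance:
  assumes G: "connected_network k G"
  shows "(consensus_h2 k G)\<^sup>2 = 1 / 2 * mat_trace (effective_resistance k G)"
proof -
  obtain V where V: "potential k G (1\<^sub>m k) V"
    "V (sink G) - V (source G) =
       transpose_mat (sink_input k G) * mat_inv (dirichlet_laplacian k G) * sink_input k G"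
    by (rule unit_potential_dirichlet[OF G])
  show ?thesis
    unfolding consensus_h2_connected_network[OF G] effective_resistance_unit_potential[OF G V(1)] V(2) ..
qed

text \<open>The same unit current crosses both graphs, so the boundary terms at the identified node
  cancel. Shifting the second potential to match there makes the two drops add.\<close>

lemma effective_resistance_series_join:
  assumes G1: "connected_network k G1" and G2: "connected_network k G2" and disj: "disjoint_graphs G1 G2"
  shows "effective_resistance k (series_join G1 G2) = effective_resistance k G1 + effective_resistance k G2"
proof -
  obtain V1 where V1: "potential k G1 (1\<^sub>m k) V1" using unit_potential_dirichlet[OF G1] by blast
  obtain V2 where V2: "potential k G2 (1\<^sub>m k) V2" using unit_potential_dirichlet[OF G2] by blast
  note c1 = potentialD(2)[OF V1] note c2 = potentialD(2)[OF V2]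
  note v1 = connected_networkD(3,4,5)[OF G1] note v2 = connected_networkD(3,4,5)[OF G2]
  have notin: "p \<notin> verts G1" if "p \<in> verts G2" for p
    using disj that by (auto simp: disjoint_graphs_def)
  let ?r = "\<lambda>v. if v = source G2 then sink G1 else v"
  define K where "K = V1 (sink G1) - V2 (source G2)"
  have K: "K \<in> carrier_mat k k" unfolding K_def by (rule minus_carrier_mat[OF c2[OF v2(1)]])
  define V where "V p = (if p \<in> verts G1 then V1 p else V2 p + K)" for p
  have V_source: "V2 (source G2) + K = V1 (sink G1)"
    unfolding K_def by (rule eq_matI) (use c1[OF v1(2)] c2[OF v2(1)] in simp_all)
  have "potential k (glue ?r (source G1) (sink G2) G1 G2) (1\<^sub>m k) V"
  proof (rule potential_glue[OF G1 G2 disj V1 V2 _ _ K one_carrier_mat])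
    show "V p = V1 p" if "p \<in> verts G1" for p using that by (simp add: V_def)
    show "V (?r p) = V2 p + K" if "p \<in> verts G2" for p
      using that notin[OF that] V_source v1(2) by (simp add: V_def)
    show "(\<phi> (sink G1) - \<phi> (source G1)) * 1\<^sub>m k $$ (a, c) +
        (\<phi> (?r (sink G2)) - \<phi> (?r (source G2))) * 1\<^sub>m k $$ (a, c) =
        (\<phi> (sink G2) - \<phi> (source G1)) * 1\<^sub>m k $$ (a, c)" for \<phi> :: "'a \<Rightarrow> real" and a c
      using v2(3) by (simp add: algebra_simps)
  qed
  from effective_resistance_unit_potential[OF connected_network_series_join[OF G1 G2 disj] this[folded series_join_def]]
  have "effective_resistance k (series_join G1 G2) = V2 (sink G2) + K - V1 (source G1)"
    using v1(1) notin[OF v2(2)] by (simp add: series_join_def glue_simps V_def)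
  also have "\<dots> = (V1 (sink G1) - V1 (source G1)) + (V2 (sink G2) - V2 (source G2))"
    unfolding K_def
    by (rule eq_matI) (use c1[OF v1(1)] c1[OF v1(2)] c2[OF v2(1)] c2[OF v2(2)] in simp_all)
  finally show ?thesis
    by (simp only: effective_resistance_unit_potential[OF G1 V1] effective_resistance_unit_potential[OF G2 V2])
qed

lemma effective_resistance_sym_pos_def:
  assumes G: "connected_network k G"
  shows "effective_resistance k G \<in> sym_pos_def k"
proof -
  obtain V where V: "potential k G (1\<^sub>m k) V" using unit_potential_dirichlet[OF G] by blast
  show ?thesis
    unfolding effective_resistance_unit_potential[OF G V] by (rule unit_potential_sym_pos_def[OF G V])
qed

lemma add_diff_cancel_mat:
  fixes A :: "real mat"
  assumes "A \<in> carrier_mat n m" "B \<in> carrier_mat n m"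
  shows "A + B - B = A"
  by (rule eq_matI) (use assms in auto)

text \<open>The equation for a is the equality of the two drops, \<open>R1 * a\<close> and
  \<open>R2 * (1 - a)\<close>. Hence a single constant shift matches the potentials at both
  terminals.\<close>

lemma effective_resistance_parallel_join:
  assumes G1: "connected_network k G1" and G2: "connected_network k G2" and disj: "disjoint_graphs G1 G2"
    and a: "a \<in> carrier_mat k k"
    and split: "(effective_resistance k G1 + effective_resistance k G2) * a = effective_resistance k G2"
  shows "effective_resistance k (parallel_join G1 G2) = effective_resistance k G1 * a"
proof -
  obtain V1 where V1: "potential k G1 (1\<^sub>m k) V1" using unit_potential_dirichlet[OF G1] by blast
  obtain V2 where V2: "potential k G2 (1\<^sub>m k) V2" using unit_potential_dirichlet[OF G2] by blast
  define b where "b = 1\<^sub>m k - a"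
  have b: "b \<in> carrier_mat k k" unfolding b_def by (rule minus_carrier_mat[OF a])
  define U1 where "U1 p = V1 p * a" for p
  define U2 where "U2 p = V2 p * b" for p
  have U1: "potential k G1 a U1" unfolding U1_def by (rule potential_mult[OF G1 V1 a])
  have U2: "potential k G2 b U2" unfolding U2_def by (rule potential_mult[OF G2 V2 b])
  note v1 = connected_networkD(3,4,5)[OF G1] note v2 = connected_networkD(3,4,5)[OF G2]
  define R1 R2 where "R1 = effective_resistance k G1" and "R2 = effective_resistance k G2"
  have R: "R1 \<in> carrier_mat k k" "R2 \<in> carrier_mat k k"
    using effective_resistance_sym_pos_def[OF G1] effective_resistance_sym_pos_def[OF G2]
    by (simp_all add: R1_def R2_def sym_pos_def_def)
  have drop1: "U1 (sink G1) - U1 (source G1) = R1 * a"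
    unfolding U1_def R1_def effective_resistance_unit_potential[OF G1 V1]
    by (rule minus_mult_distrib_mat[symmetric, OF potentialD(2)[OF V1 v1(2)] potentialD(2)[OF V1 v1(1)] a])
  have drop2: "U2 (sink G2) - U2 (source G2) = R2 * b"
    unfolding U2_def R2_def effective_resistance_unit_potential[OF G2 V2]
    by (rule minus_mult_distrib_mat[symmetric, OF potentialD(2)[OF V2 v2(2)] potentialD(2)[OF V2 v2(1)] b])
  have Ra: "R1 * a \<in> carrier_mat k k" "R2 * a \<in> carrier_mat k k"
    by (rule mult_carrier_mat[OF R(1) a]) (rule mult_carrier_mat[OF R(2) a])
  have ab: "R1 * a = R2 * b"
  proof -
    have R2: "R1 * a + R2 * a = R2"
      using split[folded R1_def R2_def] by (simp only: add_mult_distrib_mat[OF R a])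
    have "R2 * b = R2 * 1\<^sub>m k - R2 * a"
      unfolding b_def by (rule mult_minus_distrib_mat[OF R(2) one_carrier_mat a])
    also have "\<dots> = (R1 * a + R2 * a) - R2 * a" by (simp only: right_mult_one_mat[OF R(2)] R2)
    also have "\<dots> = R1 * a"
      by (rule add_diff_cancel_mat[OF Ra])
    finally show ?thesis by (rule sym)
  qed
  note c1 = potentialD(2)[OF U1] note c2 = potentialD(2)[OF U2]
  have notin: "p \<notin> verts G1" if "p \<in> verts G2" for p
    using disj that by (auto simp: disjoint_graphs_def)
  let ?r = "\<lambda>v. if v = source G2 then source G1 else if v = sink G2 then sink G1 else v"
  \<comment> \<open>K is chosen to align the sources; the sinks then agree because the drops
    do.\<close>
  define K where "K = U1 (source G1) - U2 (source G2)"
  have K: "K \<in> carrier_mat k k" unfolding K_def by (rule minus_carrier_mat[OF c2[OF v2(1)]])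
  define V where "V p = (if p \<in> verts G1 then U1 p else U2 p + K)" for p
  have V_source: "U2 (source G2) + K = U1 (source G1)"
    unfolding K_def by (rule eq_matI) (use c1[OF v1(1)] c2[OF v2(1)] in simp_all)
  have V_sink: "U2 (sink G2) + K = U1 (sink G1)"
  proof -
    have "U2 (sink G2) + K = U1 (source G1) + (U2 (sink G2) - U2 (source G2))"
      unfolding K_def by (rule eq_matI) (use c1[OF v1(1)] c2[OF v2(1)] c2[OF v2(2)] in simp_all)
    also have "\<dots> = U1 (source G1) + (U1 (sink G1) - U1 (source G1))"
      by (simp only: drop1 drop2 ab)
    also have "\<dots> = U1 (sink G1)"
      by (rule eq_matI) (use c1[OF v1(1)] c1[OF v1(2)] in simp_all)
    finally show ?thesis .
  qed
  have "potential k (glue ?r (source G1) (sink G1) G1 G2) (1\<^sub>m k) V"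
  proof (rule potential_glue[OF G1 G2 disj U1 U2 _ _ K one_carrier_mat])
    show "V p = U1 p" if "p \<in> verts G1" for p using that by (simp add: V_def)
    show "V (?r p) = U2 p + K" if "p \<in> verts G2" for p
      using that notin[OF that] V_source V_sink v1 by (simp add: V_def)
    show "(\<phi> (sink G1) - \<phi> (source G1)) * a $$ (x, y) +
        (\<phi> (?r (sink G2)) - \<phi> (?r (source G2))) * b $$ (x, y) =
        (\<phi> (sink G1) - \<phi> (source G1)) * 1\<^sub>m k $$ (x, y)"
      if "x < k" "y < k" for \<phi> :: "'a \<Rightarrow> real" and x y
    proof -
      have one: "1\<^sub>m k $$ (x, y) = a $$ (x, y) + b $$ (x, y)"
        unfolding b_def using that a by simp
      show ?thesis unfolding one using v2(3) by (simp add: algebra_simps)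
    qed
  qed
  from effective_resistance_unit_potential[OF connected_network_parallel_join[OF G1 G2 disj] this[folded parallel_join_def]]
  have "effective_resistance k (parallel_join G1 G2) = U1 (sink G1) - U1 (source G1)"
    using v1(1,2) by (simp add: parallel_join_def glue_simps V_def)
  then show ?thesis unfolding drop1 R1_def .
qed

theorem theorem1:
  fixes k :: nat and G1 G2 :: "('v, 'e) tt_graph"
  assumes "k \<ge> 1"
    and "ttsp k G1" and "ttsp k G2"
    and "disjoint_graphs G1 G2"
  shows
    "(\<forall>G\<in>{G1, G2}. (consensus_h2 k G)\<^sup>2 =
        1 / 2 * mat_trace (transpose_mat (sink_input k G) *
          mat_inv (dirichlet_laplacian k G) * sink_input k G)) \<and>
     (consensus_h2 k (series_join G1 G2))\<^sup>2 = (consensus_h2 k G1)\<^sup>2 + (consensus_h2 k G2)\<^sup>2 \<and>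
     (consensus_h2 k (parallel_join G1 G2))\<^sup>2 \<le> par_sum ((consensus_h2 k G1)\<^sup>2) ((consensus_h2 k G2)\<^sup>2) \<and>
     ((consensus_h2 k (parallel_join G1 G2))\<^sup>2 = par_sum ((consensus_h2 k G1)\<^sup>2) ((consensus_h2 k G2)\<^sup>2)
        \<longleftrightarrow> (\<exists>c>0. effective_resistance k G1 = c \<cdot>\<^sub>m effective_resistance k G2))"
proof -
  note G1 = ttsp_connected_network[OF assms(2)] and G2 = ttsp_connected_network[OF assms(3)]
  note disj = assms(4)
  define R1 R2 where "R1 = effective_resistance k G1" and "R2 = effective_resistance k G2"
  have R: "R1 \<in> sym_pos_def k" "R2 \<in> sym_pos_def k"
    unfolding R1_def R2_def by (rule effective_resistance_sym_pos_def[OF G1] effective_resistance_sym_pos_def[OF G2])+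
  then have c: "R1 \<in> carrier_mat k k" "R2 \<in> carrier_mat k k" by (simp_all add: sym_pos_def_def)
  note h2 = consensus_h2_effective_resistance
  have norm: "\<forall>G\<in>{G1, G2}. (consensus_h2 k G)\<^sup>2 = 1 / 2 * mat_trace (transpose_mat (sink_input k G) *
      mat_inv (dirichlet_laplacian k G) * sink_input k G)"
    using consensus_h2_connected_network[OF G1] consensus_h2_connected_network[OF G2] by blast
  have "mat_trace (R1 + R2) = mat_trace R1 + mat_trace R2"
    using c by (simp add: mat_trace_def sum.distrib)
  then have series: "(consensus_h2 k (series_join G1 G2))\<^sup>2 = (consensus_h2 k G1)\<^sup>2 + (consensus_h2 k G2)\<^sup>2"
    unfolding h2[OF connected_network_series_join[OF G1 G2 disj]] h2[OF G1] h2[OF G2]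
      effective_resistance_series_join[OF G1 G2 disj] R1_def[symmetric] R2_def[symmetric] by simp
  note S = sym_pos_def_add[OF R]
  note Si = sym_pos_def_mat_inv[OF S]
  have Sc: "R1 + R2 \<in> carrier_mat k k" using S by (simp add: sym_pos_def_def)
  \<comment> \<open>The sum is positive definite, so a pseudoinverse is a genuine inverse here and
    \<open>R1 * a\<close> is the matrix parallel sum of \<open>R1\<close> and
    \<open>R2\<close>.\<close>
  define a where "a = mat_inv (R1 + R2) * R2"
  have a: "a \<in> carrier_mat k k" unfolding a_def by (rule mult_carrier_mat[OF Si(1) c(2)])
  have split: "(R1 + R2) * a = R2"
    unfolding a_def by (simp only: assoc_mult_mat[OF Sc Si(1) c(2), symmetric] Si(2) left_mult_one_mat[OF c(2)])
  have parallel: "(consensus_h2 k (parallel_join G1 G2))\<^sup>2 = 1 / 2 * mat_trace (R1 * a)"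
    unfolding h2[OF connected_network_parallel_join[OF G1 G2 disj]] R1_def
    by (simp only: effective_resistance_parallel_join[OF G1 G2 disj a split[unfolded R1_def R2_def]])
  \<comment> \<open>The scalar parallel sum is homogeneous of degree one, so the factor 1/2 comes
    out; positive traces keep the denominators nonzero.\<close>
  have par: "par_sum ((consensus_h2 k G1)\<^sup>2) ((consensus_h2 k G2)\<^sup>2) = 1 / 2 * par_sum (mat_trace R1) (mat_trace R2)"
    unfolding h2[OF G1] h2[OF G2] R1_def[symmetric] R2_def[symmetric]
    using mat_trace_sym_pos_def_pos[OF R(1) assms(1)] mat_trace_sym_pos_def_pos[OF R(2) assms(1)]
    by (simp add: par_sum_def field_simps)
  show ?thesis
    using norm series mat_trace_parallel_sum[OF assms(1) R a split]
    unfolding parallel par R1_def[symmetric] R2_def[symmetric] by simp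
qed

end
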